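(* Let $q$ be an odd prime power, fix $\epsilon\in\mathbb{F}_{q^2}\setminus\mathbb{F}_q$ with $\epsilon^q=-\epsilon$ and put $\delta=\epsilon^2\in\mathbb{F}_q$. Let $a=a_0+\epsilon a_1\in\mathbb{F}_{q^2}^*$, $b=b_0+\epsilon b_1\in\mathbb{F}_{q^2}\setminus\mathbb{F}_q$ ($a_i,b_i\in\mathbb{F}_q$) with $4a^{q+1}+(b^q-b)^2\neq 0$, and let $\mathcal{M}_{a,b}$ be the BM quasi-Hermitian variety of $\mathrm{PG}(3,q^2)$, i.e. \[ \mathcal{M}_{a,b}=\{(1,x,y,z): z+a(x^2+y^2)-b(x^{q+1}+y^{q+1})\in\mathbb{F}_q\}\ \cup\ \{(0,X,Y,Z): X^{q+1}+Y^{q+1}=0\}. \] Then in the Barlotti--Cofman representation in $\mathrm{PG}(6,q)$ the affine points of $\mathcal{M}_{a,b}$ correspond to the affine points of the quadratic cone $\mathcal{B}'$ with equation \[ x_0x_6+2a_0(x_1x_2+x_3x_4)+a_1\big(x_1^2+x_3^2+\delta(x_2^2+x_4^2)\big)-b_1\big(x_1^2-\delta x_2^2+x_3^2-\delta x_4^2\big)=0, \] which has vertex $V=(0,0,0,0,0,1,0)$ and whose base is a hyperbolic quadric. The points at infinity of $\mathcal{M}_{a,b}$ correspond to $q^3+q^2+1$ spread lines, which partition the set $\{x_0=0,\ x_1^2-\delta x_2^2+x_3^2-\delta x_4^2=0\}$. Among these lines, $2q^2+1$ are contained in $\mathcal{B}'$ if $q\equiv 1\pmod 4$, whereas exactly one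 is contained in $\mathcal{B}'$ if $q\equiv 3\pmod 4$.
   Context: Points of $\mathrm{PG}(3,q^2)$ have homogeneous coordinates $(J,X,Y,Z)$, with plane at infinity $J=0$ and affine points written $(1,x,y,z)$; points of $\mathrm{PG}(6,q)$ have homogeneous coordinates $(x_0,\dots,x_6)$, with hyperplane at infinity $x_0=0$. Every $c\in\mathbb{F}_{q^2}$ is written uniquely as $c=c_0+\epsilon c_1$, $c_0,c_1\in\mathbb{F}_q$. Barlotti--Cofman representation: the affine point $(1,x,y,z)$ with $x=x_1+\epsilon x_2$, $y=x_3+\epsilon x_4$, $z=x_5+\epsilon x_6$ corresponds to $(1,x_1,\dots,x_6)$; a point $P=(0,u,v,w)$ at infinity corresponds to the spread line $r_P$ of $\{x_0=0\}$ consisting of the points $(0,u'_0,u'_1,v'_0,v'_1,w'_0,w'_1)$ with $(u',v',w')=(\lambda u,\lambda v,\lambda w)$, $\lambda\in\mathbb{F}_{q^2}^*$. The lines $r_P$ form a Desarguesian line spread of $\{x_0=0\}$. The base of the cone $\mathcal{B}'$ is the quadric of $\mathrm{PG}(5,q)$ in coordinates $x_0,x_1,x_2,x_3,x_4,x_6$ given by the same equation. *)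

theory Defs
  imports "HOL-Analysis.Analysis" "HOL-Number_Theory.Prime_Powers" "HOL-Library.Disjoint_Sets"
begin

(* Coordinates are numbered from 0: the index type of cardinality n is the type n of integers
   modulo n (Numeral_Type), with elements 0, 1, ..., n - 1. *)

definition vec4 :: "'a \<Rightarrow> 'a \<Rightarrow> 'a \<Rightarrow> 'a \<Rightarrow> 'a ^ 4" where
  "vec4 c0 c1 c2 c3 =
     (\<chi> i. if i = 0 then c0 else if i = 1 then c1 else if i = 2 then c2 else c3)"

definition vec7 :: "'a \<Rightarrow> 'a \<Rightarrow> 'a \<Rightarrow> 'a \<Rightarrow> 'a \<Rightarrow> 'a \<Rightarrow> 'a \<Rightarrow> 'a ^ 7" where
  "vec7 c0 c1 c2 c3 c4 c5 c6 =
     (\<chi> i. if i = 0 then c0 else if i = 1 then c1 else if i = 2 then c2 else if i = 3 then c3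
          else if i = 4 then c4 else if i = 5 then c5 else c6)"


(* Points of the projective space of a vector space are its one-dimensional subspaces, as sets of
   vectors; lines and other sets of points are sets of such subspaces. *)

definition proj_point :: "'a::field ^ 'n \<Rightarrow> ('a ^ 'n) set" where
  "proj_point v = vec.span {v}"

definition proj_points :: "('a::field ^ 'n) set set" where
  "proj_points = {proj_point v | v. v \<noteq> 0}"

definition proj_subspace :: "('a::field ^ 'n) set \<Rightarrow> ('a ^ 'n) set set" where
  "proj_subspace U = {P \<in> proj_points. P \<subseteq> U}"

definition proj_line :: "('a::field ^ 'n) set set \<Rightarrow> bool" where
  "proj_line l \<longleftrightarrow> (\<exists>U. vec.subspace U \<and> vec.dim U = 2 \<and> l = proj_subspace U)"

(* f is meant to be a homogeneous polynomial function, so that its vanishing at a point does not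
   depend on the representative. *)
definition proj_zeros :: "('a::field ^ 'n \<Rightarrow> 'a) \<Rightarrow> ('a ^ 'n) set set" where
  "proj_zeros f = {P \<in> proj_points. \<forall>v\<in>P. f v = 0}"

definition infinity_hyperplane :: "('a::field ^ 'n::{finite,zero}) set set" where
  "infinity_hyperplane = proj_zeros (\<lambda>v. v $ 0)"

definition affine_part ::
  "('a::field ^ 'n::{finite,zero}) set set \<Rightarrow> ('a ^ 'n::{finite,zero}) set set" where
  "affine_part S = S - infinity_hyperplane"

definition infinite_part ::
  "('a::field ^ 'n::{finite,zero}) set set \<Rightarrow> ('a ^ 'n::{finite,zero}) set set" where
  "infinite_part S = S \<inter> infinity_hyperplane"

definition proj_cone :: "('a::field ^ 'n) set \<Rightarrow> ('a ^ 'n) set set \<Rightarrow> ('a ^ 'n) set set" where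
  "proj_cone V S = insert V (\<Union>P\<in>S. proj_subspace (vec.span (V \<union> P)))"

(* A quadric of PG(5,q) is hyperbolic if it is projectively equivalent to the canonical one,
   y0 y1 + y2 y3 + y4 y5 = 0. *)
definition hyperbolic_quadric5 :: "('k::field ^ 6) set set \<Rightarrow> bool" where
  "hyperbolic_quadric5 H \<longleftrightarrow>
     (\<exists>A :: 'k ^ 6 ^ 6. invertible A \<and>
        H = (\<lambda>P. (\<lambda>v. A *v v) ` P) ` proj_zeros (\<lambda>y. y $ 0 * y $ 1 + y $ 2 * y $ 3 + y $ 4 * y $ 5))"


(* GF(q) is the type 'k, GF(q^2) the type 'a, and the inclusion is an embedding emb;
   the subfield GF(q) of GF(q^2) is thus range emb. *)

definition field_embedding :: "('k::field \<Rightarrow> 'a::field) \<Rightarrow> bool" where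
  "field_embedding emb \<longleftrightarrow>
     emb 1 = 1 \<and> (\<forall>x y. emb (x + y) = emb x + emb y) \<and> (\<forall>x y. emb (x * y) = emb x * emb y)"

definition BM_variety :: "('k::field \<Rightarrow> 'a::field) \<Rightarrow> nat \<Rightarrow> 'a \<Rightarrow> 'a \<Rightarrow> ('a ^ 4) set set" where
  "BM_variety emb q a b =
     {proj_point (vec4 1 x y z) | x y z.
        z + a * (x^2 + y^2) - b * (x^(q+1) + y^(q+1)) \<in> range emb} \<union>
     {proj_point (vec4 0 X Y Z) | X Y Z.
        (X, Y, Z) \<noteq> (0, 0, 0) \<and> X^(q+1) + Y^(q+1) = 0}"

(* (c0, c1) with c = c0 + eps c1; well defined as (1, eps) is a basis of GF(q^2) over GF(q). *)
definition coords :: "('k::field \<Rightarrow> 'a::field) \<Rightarrow> 'a \<Rightarrow> 'a \<Rightarrow> 'k \<times> 'k" where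
  "coords emb eps c = (THE p. c = emb (fst p) + eps * emb (snd p))"

(* Only used for vectors whose entry 0 is 0 or 1, for which entry 0 of the result is again 0 or 1. *)
definition bc_vec :: "('k::field \<Rightarrow> 'a::field) \<Rightarrow> 'a \<Rightarrow> 'a ^ 4 \<Rightarrow> 'k ^ 7" where
  "bc_vec emb eps v =
     vec7 (fst (coords emb eps (v $ 0)))
          (fst (coords emb eps (v $ 1))) (snd (coords emb eps (v $ 1)))
          (fst (coords emb eps (v $ 2))) (snd (coords emb eps (v $ 2)))
          (fst (coords emb eps (v $ 3))) (snd (coords emb eps (v $ 3)))"

(* An affine point has exactly one representative with entry 0 equal to 1. *)
definition bc_point :: "('k::field \<Rightarrow> 'a::field) \<Rightarrow> 'a \<Rightarrow> ('a ^ 4) set \<Rightarrow> ('k ^ 7) set" where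
  "bc_point emb eps P = vec.span (bc_vec emb eps ` {v \<in> P. v $ 0 = 1})"

(* The representatives of a point (0,u,v,w) at infinity are the vectors lambda (0,u,v,w),
   lambda nonzero in GF(q^2). *)
definition bc_line :: "('k::field \<Rightarrow> 'a::field) \<Rightarrow> 'a \<Rightarrow> ('a ^ 4) set \<Rightarrow> ('k ^ 7) set set" where
  "bc_line emb eps P = {proj_point (bc_vec emb eps v) | v. v \<in> P \<and> v \<noteq> 0}"

definition bc_spread :: "('k::field \<Rightarrow> 'a::field) \<Rightarrow> 'a \<Rightarrow> ('k ^ 7) set set set" where
  "bc_spread emb eps = bc_line emb eps ` infinity_hyperplane"

definition cone_poly ::
  "'k::field \<Rightarrow> 'k \<Rightarrow> 'k \<Rightarrow> 'k \<Rightarrow> 'k \<Rightarrow> 'k \<Rightarrow> 'k \<Rightarrow> 'k \<Rightarrow> 'k \<Rightarrow> 'k \<Rightarrow> 'k" where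
  "cone_poly \<delta> a0 a1 b1 x0 x1 x2 x3 x4 x6 =
     x0 * x6 + 2 * a0 * (x1 * x2 + x3 * x4) + a1 * (x1^2 + x3^2 + \<delta> * (x2^2 + x4^2))
       - b1 * (x1^2 - \<delta> * x2^2 + x3^2 - \<delta> * x4^2)"

definition BM_cone :: "'k::field \<Rightarrow> 'k \<Rightarrow> 'k \<Rightarrow> 'k \<Rightarrow> ('k ^ 7) set set" where
  "BM_cone \<delta> a0 a1 b1 =
     proj_zeros (\<lambda>v. cone_poly \<delta> a0 a1 b1 (v $ 0) (v $ 1) (v $ 2) (v $ 3) (v $ 4) (v $ 6))"

(* PG(5,q) has coordinates (x0,x1,x2,x3,x4,x6), so its last coordinate, of index 5, is x6. *)
definition BM_cone_base :: "'k::field \<Rightarrow> 'k \<Rightarrow> 'k \<Rightarrow> 'k \<Rightarrow> ('k ^ 6) set set" where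
  "BM_cone_base \<delta> a0 a1 b1 =
     proj_zeros (\<lambda>y. cone_poly \<delta> a0 a1 b1 (y $ 0) (y $ 1) (y $ 2) (y $ 3) (y $ 4) (y $ 5))"

(* PG(5,q) as the hyperplane x5 = 0 of PG(6,q). *)
definition embed_PG5 :: "('k::field ^ 6) set \<Rightarrow> ('k ^ 7) set" where
  "embed_PG5 P = (\<lambda>y. vec7 (y $ 0) (y $ 1) (y $ 2) (y $ 3) (y $ 4) 0 (y $ 5)) ` P"

end

theory Submission
  imports Defs
begin

text \<open>
  Write \<open>N(x) = x^(q+1)\<close>, which is \<open>x1^2 - \<delta> x2^2\<close> in coordinates. The equation of the cone is the
  vanishing of the \<open>\<epsilon>\<close>-coordinate of \<open>x0 z + a (x^2 + y^2) - b (N(x) + N(y))\<close>, which gives both the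
  affine part and, for \<open>x0 = 0\<close>, the behaviour at infinity: on a spread line of the variety
  \<open>N(X) + N(Y) = 0\<close>, so the line lies on the cone iff \<open>\<lambda>^2 a (X^2 + Y^2)\<close> is in \<open>GF(q)\<close> for all
  \<open>\<lambda>\<close>, that is, iff \<open>X^2 + Y^2 = 0\<close>. The points at infinity are \<open>(0,0,0,1)\<close> and the \<open>(0,1,t,z)\<close> with
  \<open>N(t) = -1\<close>, and it remains to count such \<open>t\<close>, resp. those with \<open>t^2 = -1\<close> as well.
  The base is \<open>x0 x6 + Q(x1,x2) + Q(x3,x4)\<close> for a binary form \<open>Q\<close>, nondegenerate by the hypothesis on
  \<open>a\<close> and \<open>b\<close>; it is hyperbolic because the discriminant of \<open>Q + Q\<close> is a square.
\<close>

section \<open>Coordinates and projective points\<close>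

lemma vec4_nth [simp]:
  "vec4 c0 c1 c2 c3 $ 0 = c0" "vec4 c0 c1 c2 c3 $ 1 = c1"
  "vec4 c0 c1 c2 c3 $ 2 = c2" "vec4 c0 c1 c2 c3 $ 3 = c3"
  by (simp_all add: vec4_def)

lemma vec7_nth [simp]:
  "vec7 c0 c1 c2 c3 c4 c5 c6 $ 0 = c0" "vec7 c0 c1 c2 c3 c4 c5 c6 $ 1 = c1"
  "vec7 c0 c1 c2 c3 c4 c5 c6 $ 2 = c2" "vec7 c0 c1 c2 c3 c4 c5 c6 $ 3 = c3"
  "vec7 c0 c1 c2 c3 c4 c5 c6 $ 4 = c4" "vec7 c0 c1 c2 c3 c4 c5 c6 $ 5 = c5"
  "vec7 c0 c1 c2 c3 c4 c5 c6 $ 6 = c6"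
  by (simp_all add: vec7_def)

definition vec6 :: "'a \<Rightarrow> 'a \<Rightarrow> 'a \<Rightarrow> 'a \<Rightarrow> 'a \<Rightarrow> 'a \<Rightarrow> 'a ^ 6" where
  "vec6 c0 c1 c2 c3 c4 c5 =
     (\<chi> i. if i = 0 then c0 else if i = 1 then c1 else if i = 2 then c2 else if i = 3 then c3
          else if i = 4 then c4 else c5)"

lemma vec6_nth [simp]:
  "vec6 c0 c1 c2 c3 c4 c5 $ 0 = c0" "vec6 c0 c1 c2 c3 c4 c5 $ 1 = c1"
  "vec6 c0 c1 c2 c3 c4 c5 $ 2 = c2" "vec6 c0 c1 c2 c3 c4 c5 $ 3 = c3"
  "vec6 c0 c1 c2 c3 c4 c5 $ 4 = c4" "vec6 c0 c1 c2 c3 c4 c5 $ 5 = c5"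
  by (simp_all add: vec6_def)

lemma exhaust_6:
  fixes x :: 6
  shows "x = 0 \<or> x = 1 \<or> x = 2 \<or> x = 3 \<or> x = 4 \<or> x = 5"
proof (induct x)
  case (of_int z)
  then have "z = 0 \<or> z = 1 \<or> z = 2 \<or> z = 3 \<or> z = 4 \<or> z = 5" by fastforce
  then show ?case by auto
qed

lemma exhaust_7:
  fixes x :: 7
  shows "x = 0 \<or> x = 1 \<or> x = 2 \<or> x = 3 \<or> x = 4 \<or> x = 5 \<or> x = 6"
proof (induct x)
  case (of_int z)
  then have "z = 0 \<or> z = 1 \<or> z = 2 \<or> z = 3 \<or> z = 4 \<or> z = 5 \<or> z = 6" by fastforce
  then show ?case by auto
qed

lemma vec_eq_iff_4:
  fixes v w :: "'a ^ 4"
  shows "v = w \<longleftrightarrow> v $ 0 = w $ 0 \<and> v $ 1 = w $ 1 \<and> v $ 2 = w $ 2 \<and> v $ 3 = w $ 3"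
proof -
  \<comment> \<open>\<open>exhaust_4\<close> lists the indices as 1, 2, 3, 4, and the last of these
    is the index 0.\<close>
  have "(4 :: 4) = 0" by simp
  then show ?thesis unfolding vec_eq_iff by (metis exhaust_4)
qed

lemma vec_eq_iff_6:
  fixes v w :: "'a ^ 6"
  shows "v = w \<longleftrightarrow> v $ 0 = w $ 0 \<and> v $ 1 = w $ 1 \<and> v $ 2 = w $ 2 \<and> v $ 3 = w $ 3
    \<and> v $ 4 = w $ 4 \<and> v $ 5 = w $ 5" (is "_ \<longleftrightarrow> ?R")
  proof (intro iffI)
  assume R: ?R
  show "v = w"
    unfolding vec_eq_iff
  proof
    fix i
    show "v $ i = w $ i" using R exhaust_6[of i] by (elim disjE) simp_all
  qed
qed simp

lemma vec_eq_iff_7: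
  fixes v w :: "'a ^ 7"
  shows "v = w \<longleftrightarrow> v $ 0 = w $ 0 \<and> v $ 1 = w $ 1 \<and> v $ 2 = w $ 2 \<and> v $ 3 = w $ 3
    \<and> v $ 4 = w $ 4 \<and> v $ 5 = w $ 5 \<and> v $ 6 = w $ 6" (is "_ \<longleftrightarrow> ?R")
  proof (intro iffI)
  assume R: ?R
  show "v = w"
    unfolding vec_eq_iff
  proof
    fix i
    show "v $ i = w $ i" using R exhaust_7[of i] by (elim disjE) simp_all
  qed
qed simp

section \<open>Points as spans of representatives, and zero sets of homogeneous forms\<close>

lemma mem_proj_point: "v \<in> proj_point w \<longleftrightarrow> (\<exists>c. v = c *s w)"
  by (auto simp: proj_point_def vec.span_singleton)

lemma proj_point_self: "v \<in> proj_point v"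
  by (simp add: proj_point_def vec.span_base)

lemma proj_point_subset_iff:
  assumes "vec.subspace U"
  shows "proj_point v \<subseteq> U \<longleftrightarrow> v \<in> U"
  using assms vec.span_minimal[of "{v}" U] proj_point_self[of v]
  by (auto simp: proj_point_def)

lemma proj_point_eqI:
  assumes "v \<in> proj_point w" "v \<noteq> 0"
  shows "proj_point v = proj_point w"
proof -
  obtain c where v: "v = c *s w" using assms(1) by (auto simp: mem_proj_point)
  then have "c \<noteq> 0" using assms(2) by auto
  then have "w = inverse c *s v" by (simp add: v)
  then have "w \<in> proj_point v" by (auto simp: mem_proj_point)
  then show ?thesis
    using assms(1) by (metis proj_point_def proj_point_subset_iff subset_antisym vec.subspace_span)
qed

lemma proj_point_scale: "c \<noteq> 0 \<Longrightarrow> proj_point (c *s v) = proj_point v"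
  using proj_point_eqI[of "c *s v" v] by (cases "v = 0") (simp, metis mem_proj_point vec.scale_eq_0_iff)

text \<open>By homogeneity, vanishing at one representative gives vanishing on the whole span, so
  the condition can be tested on a single generator.\<close>

lemma proj_zeros_eq:
  assumes "\<And>c v. f (c *s v) = c ^ d * f v"
  shows "proj_zeros f = proj_point ` {v. v \<noteq> 0 \<and> f v = 0}"
proof -
  have "(\<forall>u\<in>proj_point v. f u = 0) \<longleftrightarrow> f v = 0" for v
    using assms proj_point_self[of v] by (auto simp: mem_proj_point)
  then show ?thesis by (auto simp: proj_zeros_def proj_points_def)
qed

lemma proj_point_in_proj_zeros_iff:
  assumes "\<And>c v. f (c *s v) = c ^ d * f v" "v \<noteq> 0"
  shows "proj_point v \<in> proj_zeros f \<longleftrightarrow> f v = 0"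
  using assms proj_point_self[of v]
  by (auto simp: mem_proj_point proj_zeros_def proj_points_def)

lemma infinity_hyperplane_eq:
  "infinity_hyperplane = proj_point ` {v :: 'a::field ^ 'n::{finite,zero}. v \<noteq> 0 \<and> v $ 0 = 0}"
  unfolding infinity_hyperplane_def by (rule proj_zeros_eq[where d = 1]) simp

lemma proj_point_at_infinity_iff:
  fixes v :: "'a::field ^ 'n::{finite,zero}"
  assumes "v \<noteq> 0"
  shows "proj_point v \<in> infinity_hyperplane \<longleftrightarrow> v $ 0 = 0"
  unfolding infinity_hyperplane_def using assms
  by (intro proj_point_in_proj_zeros_iff[where d = 1]) simp_all

section \<open>Finite fields\<close>

text \<open>Multiplication by \<open>x \<noteq> 0\<close> permutes the nonzero elements, so it
  preserves their product. Comparing both products and cancelling gives the claim.\<close>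

lemma finite_field_power_card_eq:
  fixes x :: "'k::{field,finite}"
  shows "x ^ CARD('k) = x"
proof (cases "x = 0")
  case False
  have "x ^ CARD('k) * (\<Prod>y\<in>UNIV - {0}. y) = x * (x ^ (CARD('k) - 1) * (\<Prod>y\<in>UNIV - {0}. y))"
    using power_minus_mult[of "CARD('k)" x] by (simp add: ac_simps)
  also have "x ^ (CARD('k) - 1) * (\<Prod>y\<in>UNIV - {0}. y) = (\<Prod>y\<in>UNIV - {0}. x * y)"
    by (simp add: prod.distrib)
  also have "\<dots> = (\<Prod>y\<in>UNIV - {0}. y)"
    by (rule prod.reindex_bij_witness[of _ "\<lambda>y. y / x" "\<lambda>y. x * y"]) (use False in auto)
  finally show ?thesis by simp
qed simp

text \<open>Translation by 1 permutes the field, so summing all elements shows that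
  \<open>CARD('a)\<close> vanishes in the field. Hence the characteristic is a prime dividing
  \<open>p ^ n\<close>.\<close>

lemma finite_field_CHAR:
  assumes "CARD('a::{field,finite}) = p ^ n" "prime p"
  shows "CHAR('a) = p"
proof -
  have "(\<Sum>x\<in>(UNIV :: 'a set). x + 1) = (\<Sum>x\<in>UNIV. x)"
    by (rule sum.reindex_bij_witness[of _ "\<lambda>x. x - 1" "\<lambda>x. x + 1"]) auto
  then have *: "of_nat (CARD('a)) = (0 :: 'a)"
    by (simp add: sum.distrib)
  then have "CHAR('a) > 0" by (metis CHAR_pos_iff finite_UNIV_card_ge_0 finite)
  then have "prime CHAR('a)" by (rule prime_CHAR_semidom)
  moreover have "CHAR('a) dvd p ^ n" using * assms(1) by (metis of_nat_eq_0_iff_char_dvd)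
  ultimately show ?thesis
    using assms(2) by (metis prime_dvd_power primes_dvd_imp_eq)
qed

text \<open>The elements counted are roots of the monic polynomial \<open>X^n - c\<close>. This
  bounds the fibres of squaring and, later, of the norm.\<close>

lemma card_power_roots_le:
  fixes c :: "'a::idom"
  assumes "n > 0"
  shows "card {x. x ^ n = c} \<le> n"
proof -
  let ?p = "monom 1 n - [:c:]"
  have "coeff ?p n = 1" using assms by (cases n) (auto simp: coeff_pCons)
  then have "?p \<noteq> 0" by (metis coeff_0 zero_neq_one)
  moreover have "{x. x ^ n = c} = {x. poly ?p x = 0}" by (auto simp: poly_monom)
  moreover have "degree ?p \<le> n"
    by (rule degree_diff_le) (auto simp: degree_monom_le)
  ultimately show ?thesis using card_poly_roots_bound[of ?p] by simp
qed

text \<open>Pigeonhole: squaring has one preimage of 0 and at most two of any other element, so more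
  than half of the field consists of squares. The set \<open>S\<close> of squares and
  \<open>e - S\<close> have the same size and therefore meet.\<close>

lemma sum_of_two_squares:
  fixes e :: "'k::{field,finite}"
  shows "\<exists>c d. c\<^sup>2 + d\<^sup>2 = e"
proof -
  define S where "S = range (\<lambda>x::'k. x\<^sup>2)"
  have S0: "0 \<in> S" by (auto simp: S_def image_iff intro!: exI[of _ 0])
  have "UNIV = (\<Union>s\<in>S. {x. x\<^sup>2 = s})" by (auto simp: S_def)
  then have "CARD('k) = card (\<Union>s\<in>S. {x. x\<^sup>2 = s})" by simp
  also have "\<dots> \<le> (\<Sum>s\<in>S. card {x. x\<^sup>2 = s})" by (rule card_UN_le) simp
  also have "\<dots> = card {x::'k. x\<^sup>2 = 0} + (\<Sum>s\<in>S - {0}. card {x. x\<^sup>2 = s})"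
    using S0 by (simp add: sum.remove)
  also have "\<dots> \<le> 1 + (\<Sum>s\<in>S - {0}. 2)"
    by (intro add_mono sum_mono card_power_roots_le) auto
  also have "\<dots> = 1 + 2 * (card S - 1)" using S0 by simp
  finally have 1: "CARD('k) + 1 \<le> 2 * card S"
    using S0 by (cases "card S") auto
  have "S \<inter> (\<lambda>s. e - s) ` S \<noteq> {}"
  proof
    assume "S \<inter> (\<lambda>s. e - s) ` S = {}"
    then have "card (S \<union> (\<lambda>s. e - s) ` S) = card S + card ((\<lambda>s. e - s) ` S)"
      by (intro card_Un_disjoint) auto
    moreover have "card ((\<lambda>s. e - s) ` S) = card S" by (rule card_image) (auto simp: inj_on_def)
    moreover have "card (S \<union> (\<lambda>s. e - s) ` S) \<le> CARD('k)" by (rule card_mono) auto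
    ultimately show False using 1 by simp
  qed
  then show ?thesis by (auto simp: S_def) (metis diff_add_cancel)
qed

lemma minus_one_square:
  assumes "CARD('k::{field,finite}) mod 4 = 1"
  shows "\<exists>i::'k. i\<^sup>2 = -1"
proof -
  define m where "m = (CARD('k) - 1) div 4"
  have m: "CARD('k) = 4 * m + 1" using assms unfolding m_def by presburger
  have "CARD('k) \<ge> 2" using card_mono[of UNIV "{0::'k, 1}"] by simp
  then have "m > 0" using m by simp
  \<comment> \<open>\<open>x^(4m) = 1\<close> for all \<open>x \<noteq> 0\<close>, and \<open>x^m\<close> is a square root of \<open>-1\<close> as soon as \<open>x^(2m) \<noteq> 1\<close>.\<close>
  have "\<exists>x::'k. x \<noteq> 0 \<and> x ^ (2 * m) \<noteq> 1"
  proof (rule ccontr)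
    assume "\<not> ?thesis"
    then have "UNIV - {0} \<subseteq> {x::'k. x ^ (2 * m) = 1}" by auto
    then have "card (UNIV - {0::'k}) \<le> card {x::'k. x ^ (2 * m) = 1}" by (intro card_mono) auto
    also have "\<dots> \<le> 2 * m" using \<open>m > 0\<close> by (intro card_power_roots_le) simp
    finally show False using m \<open>m > 0\<close> by simp
  qed
  then obtain x :: 'k where x: "x \<noteq> 0" "x ^ (2 * m) \<noteq> 1" by blast
  have "x * ((x ^ (2 * m))\<^sup>2) = x"
    using finite_field_power_card_eq[of x] by (simp add: m power_mult[symmetric] mult.commute)
  then have "(x ^ (2 * m))\<^sup>2 = 1" using x(1) by simp
  then have "x ^ (2 * m) = -1" using x(2) by (simp add: power2_eq_1_iff)
  then have "(x ^ m)\<^sup>2 = -1" by (simp add: power_mult[symmetric] mult.commute)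
  then show ?thesis ..
qed

section \<open>The cone and its base\<close>

lemma embed_PG5_proj_point:
  "embed_PG5 (proj_point y) = proj_point (vec7 (y $ 0) (y $ 1) (y $ 2) (y $ 3) (y $ 4) 0 (y $ 5))"
proof -
  have "vec7 ((c *s y) $ 0) ((c *s y) $ 1) ((c *s y) $ 2) ((c *s y) $ 3) ((c *s y) $ 4) 0 ((c *s y) $ 5)
    = c *s vec7 (y $ 0) (y $ 1) (y $ 2) (y $ 3) (y $ 4) 0 (y $ 5)" for c
    by (simp add: vec_eq_iff_7)
  then show ?thesis
    unfolding embed_PG5_def proj_point_def vec.span_singleton image_image by simp
qed

lemma mem_span_proj_points:
  fixes u v w :: "'a::field ^ 'n"
  shows "v \<in> vec.span (proj_point u \<union> proj_point w) \<longleftrightarrow> (\<exists>c d. v = c *s u + d *s w)"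
proof -
  have *: "vec.span (proj_point u) = proj_point u" for u :: "'a ^ 'n"
    by (simp add: proj_point_def)
  have "vec.span (proj_point u \<union> proj_point w) = {x + y | x y. x \<in> proj_point u \<and> y \<in> proj_point w}"
    by (simp only: vec.span_Un *)
  then show ?thesis by (auto simp: mem_proj_point)
qed

lemma proj_subspace_eq: "vec.subspace U \<Longrightarrow> proj_subspace U = proj_point ` {v \<in> U. v \<noteq> 0}"
  unfolding proj_subspace_def proj_points_def by (blast dest: iffD1[OF proj_point_subset_iff] iffD2[OF proj_point_subset_iff])

lemma cone_poly_homogeneous:
  "cone_poly \<delta> a0 a1 b1 (c * x0) (c * x1) (c * x2) (c * x3) (c * x4) (c * x6)
    = c\<^sup>2 * cone_poly \<delta> a0 a1 b1 x0 x1 x2 x3 x4 x6"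
  by (simp add: cone_poly_def power2_eq_square algebra_simps)

lemma BM_cone_eq:
  "BM_cone \<delta> a0 a1 b1 = proj_point `
    {v. v \<noteq> 0 \<and> cone_poly \<delta> a0 a1 b1 (v $ 0) (v $ 1) (v $ 2) (v $ 3) (v $ 4) (v $ 6) = 0}"
  unfolding BM_cone_def
  by (rule proj_zeros_eq[where d = 2]) (simp add: cone_poly_homogeneous)

lemma BM_cone_base_eq:
  "BM_cone_base \<delta> a0 a1 b1 = proj_point `
    {v. v \<noteq> 0 \<and> cone_poly \<delta> a0 a1 b1 (v $ 0) (v $ 1) (v $ 2) (v $ 3) (v $ 4) (v $ 5) = 0}"
  unfolding BM_cone_base_def
  by (rule proj_zeros_eq[where d = 2]) (simp add: cone_poly_homogeneous)

text \<open>The equation does not involve \<open>x5\<close>, so adding a multiple of the vertex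
  vector preserves it, and dropping \<open>x5\<close> projects the cone from the vertex onto the
  base.\<close>

lemma BM_cone_conv_proj_cone:
  fixes \<delta> :: "'k::field"
  shows "BM_cone \<delta> a0 a1 b1
    = proj_cone (proj_point (vec7 0 0 0 0 0 1 0)) (embed_PG5 ` BM_cone_base \<delta> a0 a1 b1)"
    (is "_ = proj_cone (proj_point ?e) _")
proof -
  let ?f = "\<lambda>v. cone_poly \<delta> a0 a1 b1 (v $ 0) (v $ 1) (v $ 2) (v $ 3) (v $ 4) (v $ 6)"
  let ?g = "\<lambda>v. cone_poly \<delta> a0 a1 b1 (v $ 0) (v $ 1) (v $ 2) (v $ 3) (v $ 4) (v $ 5)"
  let ?w = "\<lambda>y :: 'k ^ 6. vec7 (y $ 0) (y $ 1) (y $ 2) (y $ 3) (y $ 4) 0 (y $ 5)"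
  have e: "?e \<noteq> 0" by (simp add: vec_eq_iff_7)
  have cone: "proj_cone (proj_point ?e) (embed_PG5 ` BM_cone_base \<delta> a0 a1 b1)
    = insert (proj_point ?e) (\<Union>y\<in>{y. y \<noteq> 0 \<and> ?g y = 0}.
        proj_point ` {v. v \<noteq> 0 \<and> (\<exists>c d. v = c *s ?e + d *s ?w y)})" (is "_ = ?R")
    unfolding proj_cone_def BM_cone_base_eq image_image embed_PG5_proj_point
      proj_subspace_eq[OF vec.subspace_span] mem_span_proj_points
    by (simp add: conj_commute Collect_conj_eq)
  show ?thesis
    unfolding cone
  proof (intro subset_antisym subsetI)
    fix P assume "P \<in> BM_cone \<delta> a0 a1 b1"
    then obtain v where v: "P = proj_point v" "v \<noteq> 0" "?f v = 0" by (auto simp: BM_cone_eq)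
    let ?y = "vec6 (v $ 0) (v $ 1) (v $ 2) (v $ 3) (v $ 4) (v $ 6)"
    have *: "v = (v $ 5) *s ?e + 1 *s ?w ?y" by (simp add: vec_eq_iff_7)
    \<comment> \<open>Dropping \<open>x5\<close> gives the zero vector only for the vertex, which is
      no cone over a base point and is covered by the inserted element instead.\<close>
    show "P \<in> ?R"
    proof (cases "?y = 0")
      case True
      then have "v = (v $ 5) *s ?e" by (simp add: vec_eq_iff_6 vec_eq_iff_7)
      then have "v \<in> proj_point ?e" by (auto simp: mem_proj_point)
      then show ?thesis using v by (simp add: proj_point_eqI)
    next
      case False
      moreover have "?g ?y = 0" using v by simp
      ultimately show ?thesis using v * by blast
    qed
  next
    fix P assume "P \<in> ?R"
    then consider "P = proj_point ?e"
      | y c d v where "?g y = 0" "P = proj_point v" "v \<noteq> 0" "v = c *s ?e + d *s ?w y"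
      by blast
    then show "P \<in> BM_cone \<delta> a0 a1 b1"
    proof cases
      case 1
      have "?f ?e = 0" by (simp add: cone_poly_def)
      then show ?thesis using 1 e by (auto simp: BM_cone_eq)
    next
      case 2
      have "?f v = 0" using 2(1) by (simp add: 2(4) cone_poly_homogeneous)
      then show ?thesis using 2 by (auto simp: BM_cone_eq)
    qed
  qed
qed

section \<open>Hyperbolicity of the base\<close>

text \<open>An injective linear endomorphism is invertible. As \<open>f\<close> is the pullback of
  the canonical form along \<open>\<phi>\<close>, its zero set is the image of the canonical quadric
  under the inverse, so the required matrix is the inverse of that of \<open>\<phi>\<close>.\<close>

lemma hyperbolic_quadric5I:
  fixes \<phi> :: "'k::field ^ 6 \<Rightarrow> 'k ^ 6"
  assumes lin: "Vector_Spaces.linear (*s) (*s) \<phi>" and inj: "\<And>v. \<phi> v = 0 \<Longrightarrow> v = 0"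
    and f: "\<And>v. f v = \<phi> v $ 0 * \<phi> v $ 1 + \<phi> v $ 2 * \<phi> v $ 3 + \<phi> v $ 4 * \<phi> v $ 5"
  shows "hyperbolic_quadric5 (proj_zeros f)"
proof -
  let ?h = "\<lambda>y :: 'k ^ 6. y $ 0 * y $ 1 + y $ 2 * y $ 3 + y $ 4 * y $ 5"
  define M where "M = matrix \<phi>"
  have \<phi>: "\<phi> v = M *v v" for v by (simp add: M_def matrix_works[OF lin])
  have "\<forall>x. M *v x = 0 \<longrightarrow> x = 0" using inj unfolding \<phi> by blast
  then have "\<exists>A. A ** M = mat 1" by (simp only: matrix_left_invertible_ker)
  then obtain A where A: "A ** M = mat 1" ..
  then have A': "M ** A = mat 1" by (rule matrix_left_right_inverse1)
  have inv1: "A *v \<phi> v = v" for v by (simp add: \<phi> matrix_vector_mul_assoc A)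
  have inv2: "\<phi> (A *v v) = v" for v by (simp add: \<phi> matrix_vector_mul_assoc A')
  have hom_h: "?h (c *s v) = c ^ 2 * ?h v" for c v
    by (simp add: power2_eq_square algebra_simps)
  have "\<phi> (c *s v) = c *s \<phi> v" for c v by (simp add: \<phi> vector_scalar_commute)
  then have hom_f: "f (c *s v) = c ^ 2 * f v" for c v
    by (simp only: f hom_h)
  have im: "(*v) A ` proj_point v = proj_point (A *v v)" for v
    by (simp add: proj_point_def vec.span_singleton image_image vector_scalar_commute)
  have "proj_zeros f = proj_point ` {v. v \<noteq> 0 \<and> ?h (\<phi> v) = 0}"
    unfolding proj_zeros_eq[of f 2, OF hom_f] by (simp add: f)
  also have "{v. v \<noteq> 0 \<and> ?h (\<phi> v) = 0} = (*v) A ` {v. v \<noteq> 0 \<and> ?h v = 0}"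
  proof (intro subset_antisym subsetI)
    fix v assume "v \<in> {v. v \<noteq> 0 \<and> ?h (\<phi> v) = 0}"
    then have "\<phi> v \<in> {v. v \<noteq> 0 \<and> ?h v = 0}" using inj by blast
    then show "v \<in> (*v) A ` {v. v \<noteq> 0 \<and> ?h v = 0}" by (rule image_eqI[rotated]) (simp add: inv1)
  next
    fix v assume "v \<in> (*v) A ` {v. v \<noteq> 0 \<and> ?h v = 0}"
    then obtain w where w: "v = A *v w" "w \<noteq> 0" "?h w = 0" by blast
    then have "\<phi> v = w" by (simp add: inv2)
    moreover have "v \<noteq> 0" using w(2) \<open>\<phi> v = w\<close> by (auto simp: \<phi>)
    ultimately show "v \<in> {v. v \<noteq> 0 \<and> ?h (\<phi> v) = 0}" using w by simp
  qed
  finally have "proj_zeros f = (\<lambda>P. (*v) A ` P) ` proj_zeros ?h"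
    unfolding proj_zeros_eq[of ?h 2, OF hom_h] by (simp only: image_image im)
  moreover have "invertible A" unfolding invertible_def using A A' by blast
  ultimately show ?thesis unfolding hyperbolic_quadric5_def by blast
qed

text \<open>Complete the square in a variable whose square has a nonzero coefficient. The
  determinant condition records that the new linear forms are independent.\<close>

lemma diagonalize_binary_form:
  fixes A B C :: "'k::field"
  assumes "(2::'k) \<noteq> 0" and "B\<^sup>2 - A * C \<noteq> 0"
  shows "\<exists>\<alpha> \<beta> p r p' r'. \<alpha> \<noteq> 0 \<and> \<beta> \<noteq> 0 \<and> p * r' - p' * r \<noteq> 0 \<and>
    (\<forall>s t. A * s\<^sup>2 + 2 * B * s * t + C * t\<^sup>2 = \<alpha> * (p * s + r * t)\<^sup>2 + \<beta> * (p' * s + r' * t)\<^sup>2)"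
proof -
  consider "A \<noteq> 0" | "C \<noteq> 0" | "A = 0" "C = 0" by blast
  then show ?thesis
  proof cases
    case 1
    define m where "m = B / A"
    have B: "B = A * m" using 1 by (simp add: m_def)
    have "A * (C - A * m\<^sup>2) \<noteq> 0" using assms(2) by (auto simp: B power2_eq_square algebra_simps)
    then have "C - A * m\<^sup>2 \<noteq> 0" by simp
    moreover have "A * s\<^sup>2 + 2 * B * s * t + C * t\<^sup>2
        = A * (1 * s + m * t)\<^sup>2 + (C - A * m\<^sup>2) * (0 * s + 1 * t)\<^sup>2" for s t
      by (simp add: B power2_eq_square algebra_simps)
    moreover have "1 * 1 - 0 * m \<noteq> 0" by simp
    ultimately show ?thesis using 1 by blast
  next
    case 2
    define m where "m = B / C"
    have B: "B = C * m" using 2 by (simp add: m_def)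
    have "C * (A - C * m\<^sup>2) \<noteq> 0" using assms(2) by (auto simp: B power2_eq_square algebra_simps)
    then have "A - C * m\<^sup>2 \<noteq> 0" by simp
    moreover have "A * s\<^sup>2 + 2 * B * s * t + C * t\<^sup>2
        = C * (m * s + 1 * t)\<^sup>2 + (A - C * m\<^sup>2) * (1 * s + 0 * t)\<^sup>2" for s t
      by (simp add: B power2_eq_square algebra_simps)
    moreover have "m * 0 - 1 * 1 \<noteq> 0" by simp
    ultimately show ?thesis using 2 by blast
  next
    case 3
    \<comment> \<open>The form is now \<open>4 h s t\<close>, which is
      \<open>h ((s + t)^2 - (s - t)^2)\<close>.\<close>
    define h where "h = B / 2"
    have B: "B = 2 * h" using assms(1) by (simp add: h_def)
    have "h \<noteq> 0" "- h \<noteq> 0" using 3 assms by (auto simp: B)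
    moreover have "A * s\<^sup>2 + 2 * B * s * t + C * t\<^sup>2
        = h * (1 * s + 1 * t)\<^sup>2 + - h * (1 * s + (-1) * t)\<^sup>2" for s t
      using 3 by (simp add: B power2_eq_square algebra_simps)
    moreover have "1 * (-1) - 1 * (1::'k) \<noteq> 0" using assms(1) by simp
    ultimately show ?thesis by blast
  qed
qed

lemma hyperbolic_BM_cone_base:
  fixes \<delta> :: "'k::{field,finite}"
  assumes two: "(2::'k) \<noteq> 0" and disc: "a0\<^sup>2 - \<delta> * (a1\<^sup>2 - b1\<^sup>2) \<noteq> 0"
  shows "hyperbolic_quadric5 (BM_cone_base \<delta> a0 a1 b1)"
proof -
  \<comment> \<open>This is \<open>B^2 - A C\<close> for the binary form that the equation induces
    on \<open>(x1, x2)\<close> and, identically, on \<open>(x3, x4)\<close>.\<close>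
  have "a0\<^sup>2 - (a1 - b1) * (\<delta> * (a1 + b1)) \<noteq> 0"
    using disc by (simp add: power2_eq_square algebra_simps)
  from diagonalize_binary_form[OF two this] obtain \<alpha> \<beta> p r p' r' where
    \<alpha>: "\<alpha> \<noteq> 0" and \<beta>: "\<beta> \<noteq> 0" and det: "p * r' - p' * r \<noteq> 0" and
    Q: "\<And>s t. (a1 - b1) * s\<^sup>2 + 2 * a0 * s * t + \<delta> * (a1 + b1) * t\<^sup>2
      = \<alpha> * (p * s + r * t)\<^sup>2 + \<beta> * (p' * s + r' * t)\<^sup>2" by blast
  \<comment> \<open>Since two squares always suffice, no case distinction on whether
    \<open>- \<beta> / \<alpha>\<close> is itself a square is needed.\<close>
  obtain c d where cd: "c\<^sup>2 + d\<^sup>2 = - \<beta> / \<alpha>" using sum_of_two_squares by blast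
  then have \<beta>_eq: "\<beta> = - \<alpha> * (c\<^sup>2 + d\<^sup>2)" and cd0: "c\<^sup>2 + d\<^sup>2 \<noteq> 0" using \<alpha> \<beta> by auto
  \<comment> \<open>With \<open>g = c w1 + d w2\<close>, \<open>h = c w2 - d w1\<close> one has \<open>g^2 + h^2 = (c^2 + d^2) (w1^2 + w2^2)\<close>, so
    \<open>\<alpha> (u1^2 + u2^2) + \<beta> (w1^2 + w2^2)\<close> is \<open>\<alpha>\<close> times the sum of two differences of squares.\<close>
  define u where "u s t = p * s + r * t" for s t
  define w where "w s t = p' * s + r' * t" for s t
  define g where "g v = c * w (v $ 1) (v $ 2) + d * w (v $ 3) (v $ 4)" for v :: "'k ^ 6"
  define h where "h v = c * w (v $ 3) (v $ 4) - d * w (v $ 1) (v $ 2)" for v :: "'k ^ 6"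
  \<comment> \<open>Factoring \<open>u1^2 - g^2\<close> and \<open>u2^2 - h^2\<close> yields two of
    the coordinate pairs of the canonical form, with \<open>\<alpha>\<close> put into one factor of
    each. The remaining pair is \<open>x0\<close>, \<open>x6\<close>.\<close>
  define \<phi> where "\<phi> v = vec6 (v $ 0) (v $ 5) (\<alpha> * (u (v $ 1) (v $ 2) - g v)) (u (v $ 1) (v $ 2) + g v)
      (\<alpha> * (u (v $ 3) (v $ 4) - h v)) (u (v $ 3) (v $ 4) + h v)" for v
  have uw0: "s = 0 \<and> t = 0" if "u s t = 0" "w s t = 0" for s t
  proof -
    \<comment> \<open>Cramer's rule.\<close>
    have "(p * r' - p' * r) * s = r' * u s t - r * w s t"
      and "(p * r' - p' * r) * t = p * w s t - p' * u s t"
      by (simp_all add: u_def w_def algebra_simps)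
    then have "(p * r' - p' * r) * s = 0" "(p * r' - p' * r) * t = 0" by (simp_all only: that) simp_all
    then show ?thesis using det by (metis mult_eq_0_iff)
  qed
  have split: "x = 0 \<and> y = 0" if "\<alpha> * (x - y) = 0" "x + y = 0" for x y
  proof -
    have "x = y" using that(1) \<alpha> by simp
    then have "2 * y = 0" using that(2) by (simp only: mult_2)
    then have "y = 0" using two by simp
    then show ?thesis using \<open>x = y\<close> by simp
  qed
  show ?thesis
    unfolding BM_cone_base_def
  proof (rule hyperbolic_quadric5I)
    show "Vector_Spaces.linear (*s) (*s) \<phi>"
      unfolding Vector_Spaces.linear_iff
      by (simp add: vec.vector_space_axioms vec_eq_iff_6 \<phi>_def u_def w_def g_def h_def algebra_simps)
  next
    fix v assume "\<phi> v = 0"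
    then have z: "v $ 0 = 0" "v $ 5 = 0" "u (v $ 1) (v $ 2) = 0" "g v = 0"
       "u (v $ 3) (v $ 4) = 0" "h v = 0"
      using split[of "u (v $ 1) (v $ 2)" "g v"] split[of "u (v $ 3) (v $ 4)" "h v"]
      by (simp_all add: vec_eq_iff_6 \<phi>_def del: mult_eq_0_iff)
    \<comment> \<open>The map \<open>(w1, w2) \<mapsto> (g, h)\<close> has determinant
      \<open>c^2 + d^2\<close>; these identities invert it.\<close>
    have "(c\<^sup>2 + d\<^sup>2) * w (v $ 1) (v $ 2) = c * g v - d * h v"
      and "(c\<^sup>2 + d\<^sup>2) * w (v $ 3) (v $ 4) = d * g v + c * h v"
      by (simp_all add: g_def h_def power2_eq_square algebra_simps)
    then have "w (v $ 1) (v $ 2) = 0" "w (v $ 3) (v $ 4) = 0" using z cd0 by simp_all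
    then show "v = 0" using z uw0[of "v $ 1" "v $ 2"] uw0[of "v $ 3" "v $ 4"] by (simp add: vec_eq_iff_6)
  next
    fix v :: "'k ^ 6"
    have "cone_poly \<delta> a0 a1 b1 (v $ 0) (v $ 1) (v $ 2) (v $ 3) (v $ 4) (v $ 5)
      = v $ 0 * v $ 5 + ((a1 - b1) * (v $ 1)\<^sup>2 + 2 * a0 * v $ 1 * v $ 2 + \<delta> * (a1 + b1) * (v $ 2)\<^sup>2)
        + ((a1 - b1) * (v $ 3)\<^sup>2 + 2 * a0 * v $ 3 * v $ 4 + \<delta> * (a1 + b1) * (v $ 4)\<^sup>2)"
      by (simp add: cone_poly_def algebra_simps)
    also have "\<dots> = v $ 0 * v $ 5 + (\<alpha> * (u (v $ 1) (v $ 2))\<^sup>2 + \<beta> * (w (v $ 1) (v $ 2))\<^sup>2)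
        + (\<alpha> * (u (v $ 3) (v $ 4))\<^sup>2 + \<beta> * (w (v $ 3) (v $ 4))\<^sup>2)"
      by (simp only: Q u_def w_def)
    also have "\<dots> = \<phi> v $ 0 * \<phi> v $ 1 + \<phi> v $ 2 * \<phi> v $ 3 + \<phi> v $ 4 * \<phi> v $ 5"
      unfolding \<beta>_eq by (simp add: \<phi>_def g_def h_def power2_eq_square algebra_simps)
    finally show "cone_poly \<delta> a0 a1 b1 (v $ 0) (v $ 1) (v $ 2) (v $ 3) (v $ 4) (v $ 5)
      = \<phi> v $ 0 * \<phi> v $ 1 + \<phi> v $ 2 * \<phi> v $ 3 + \<phi> v $ 4 * \<phi> v $ 5" .
  qed
qed

section \<open>The quadratic extension and the Barlotti--Cofman representation\<close>

locale quadratic_extension =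
  fixes emb :: "'k::{field,finite} \<Rightarrow> 'a::{field,finite}"
    and q :: nat and eps :: 'a and \<delta> :: 'k
  assumes primepow: "primepow q" and odd_q: "odd q"
    and card_base: "CARD('k) = q" and card_ext: "CARD('a) = q\<^sup>2"
    and emb: "field_embedding emb"
    and eps_notin: "eps \<notin> range emb" and eps_power: "eps ^ q = - eps"
    and emb_\<delta>: "emb \<delta> = eps\<^sup>2"
begin

section \<open>The embedding of GF(q), the characteristic and the Frobenius map\<close>

lemma emb_1 [simp]: "emb 1 = 1"
  and emb_add [simp]: "emb (x + y) = emb x + emb y"
  and emb_mult [simp]: "emb (x * y) = emb x * emb y"
  using emb by (simp_all add: field_embedding_def)

lemma emb_0 [simp]: "emb 0 = 0"
  by (metis add.right_neutral add_left_cancel emb_add)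

lemma emb_minus [simp]: "emb (- x) = - emb x"
  using emb_add[of x "- x"] by (simp add: eq_neg_iff_add_eq_0 add.commute)

lemma emb_diff [simp]: "emb (x - y) = emb x - emb y"
  using emb_add[of x "- y"] by simp

lemma emb_power [simp]: "emb (x ^ n) = emb x ^ n"
  by (induction n) simp_all

lemma emb_eq_0_iff [simp]: "emb x = 0 \<longleftrightarrow> x = 0"
proof
  assume *: "emb x = 0"
  show "x = 0"
  proof (rule ccontr)
    assume "x \<noteq> 0"
    then have "emb x * emb (inverse x) = 1" by (simp flip: emb_mult)
    then show False using * by simp
  qed
qed simp

lemma emb_eq_iff [simp]: "emb x = emb y \<longleftrightarrow> x = y"
  using emb_eq_0_iff[of "x - y"] by simp

lemma CHAR_base_ext: "\<exists>p n. prime p \<and> q = p ^ n \<and> CHAR('k) = p \<and> CHAR('a) = p"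
proof -
  obtain p n where p: "prime p" "q = p ^ n" using primepow by (auto simp: primepow_def)
  then have "CARD('k) = p ^ n" "CARD('a) = p ^ (n * 2)"
    by (simp_all add: card_base card_ext power_mult)
  then have "CHAR('k) = p" "CHAR('a) = p" using p(1) by (simp_all add: finite_field_CHAR)
  with p show ?thesis by blast
qed

lemma two_neq_0: "(2::'k) \<noteq> 0"
proof
  assume "(2::'k) = 0"
  then have "of_nat 2 = (0::'k)" by simp
  then have "CHAR('k) dvd 2" by (simp only: of_nat_eq_0_iff_char_dvd)
  moreover obtain p n where "prime p" "q = p ^ n" "CHAR('k) = p" using CHAR_base_ext by blast
  ultimately have "p = 2" using primes_dvd_imp_eq two_is_prime_nat by blast
  \<comment> \<open>A positive exponent makes \<open>2 ^ n\<close> even; \<open>n = 0\<close> is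
    impossible because a prime power exceeds 1.\<close>
  moreover have "n \<noteq> 0" using primepow_gt_Suc_0[OF primepow] \<open>q = p ^ n\<close> by (cases n) simp_all
  ultimately show False using odd_q \<open>q = p ^ n\<close> by simp
qed

text \<open>\<open>q\<close> is a power of the characteristic, so the q-th power is an iterate of
  the Frobenius map.\<close>

lemma power_q_add: "(x + y :: 'a) ^ q = x ^ q + y ^ q"
proof -
  obtain p n where "prime p" "q = p ^ n" "CHAR('a) = p" using CHAR_base_ext by blast
  then show ?thesis using freshmans_dream'[where 'a = 'a and m = q and n = n] by simp
qed

lemma emb_power_q: "emb x ^ q = emb x"
  using finite_field_power_card_eq[of x] by (simp add: card_base flip: emb_power)

section \<open>Arithmetic of GF(q^2) in coordinates over GF(q)\<close>

text \<open>A constructor inverse to \<open>coords\<close>: computations in GF(q^2) turn into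
  rewriting of the two components over GF(q).\<close>

definition elt :: "'k \<Rightarrow> 'k \<Rightarrow> 'a" where
  "elt s t = emb s + eps * emb t"

text \<open>If the second components differed, \<open>eps\<close> would be a quotient of elements of
  \<open>range emb\<close> and hence lie in this subfield.\<close>

lemma elt_eq_iff [simp]: "elt s t = elt s' t' \<longleftrightarrow> s = s' \<and> t = t'"
proof
  assume *: "elt s t = elt s' t'"
  have "t = t'"
  proof (rule ccontr)
    assume "t \<noteq> t'"
    then have "emb (t - t') \<noteq> 0" by (simp del: emb_diff)
    moreover have "eps * emb (t - t') = emb (s' - s)"
      using * by (simp add: elt_def algebra_simps)
    moreover have "emb (t - t') * emb ((s' - s) / (t - t')) = emb (s' - s)"
      using \<open>t \<noteq> t'\<close> by (simp flip: emb_mult emb_diff)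
    ultimately have "eps = emb ((s' - s) / (t - t'))"
      by (metis mult.commute mult_left_cancel)
    then show False using eps_notin by blast
  qed
  then show "s = s' \<and> t = t'" using * by (simp add: elt_def)
qed simp

text \<open>Surjectivity by counting: there are as many pairs as elements of GF(q^2), and the map is
  injective.\<close>

lemma range_elt: "range (\<lambda>p. elt (fst p) (snd p)) = UNIV"
proof (rule card_subset_eq)
  have "inj (\<lambda>p. elt (fst p) (snd p))" by (simp add: inj_on_def prod_eq_iff)
  then show "card (range (\<lambda>p. elt (fst p) (snd p))) = CARD('a)"
    by (simp add: card_image card_ext card_base power2_eq_square)
qed simp_all

lemma elt_cases: obtains s t where "x = elt s t"
proof -
  have "x \<in> range (\<lambda>p. elt (fst p) (snd p))" by (simp add: range_elt)
  then show ?thesis by (elim imageE) (rule that)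
qed

lemma emb_conv_elt: "emb s = elt s 0"
  by (simp add: elt_def)

lemma elt_mem_range_emb [simp]: "elt s t \<in> range emb \<longleftrightarrow> t = 0"
  by (auto simp: emb_conv_elt)

lemma elt_add: "elt s t + elt s' t' = elt (s + s') (t + t')"
  by (simp add: elt_def algebra_simps)

lemma elt_diff: "elt s t - elt s' t' = elt (s - s') (t - t')"
  by (simp add: elt_def algebra_simps)

lemma elt_mult: "elt s t * elt s' t' = elt (s * s' + \<delta> * t * t') (s * t' + t * s')"
  by (simp add: elt_def emb_\<delta> power2_eq_square algebra_simps)

lemma elt_square: "(elt s t)\<^sup>2 = elt (s\<^sup>2 + \<delta> * t\<^sup>2) (2 * s * t)"
  by (simp add: power2_eq_square elt_mult algebra_simps)

text \<open>The q-th power is additive, fixes GF(q) and negates \<open>eps\<close>, so it is the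
  conjugation. Multiplying an element by its conjugate then gives the norm form of
  \<open>elt_norm\<close>.\<close>

lemma elt_power_q: "elt s t ^ q = elt s (- t)"
  by (simp add: elt_def power_q_add power_mult_distrib emb_power_q eps_power)

lemma elt_norm: "elt s t ^ (q + 1) = elt (s\<^sup>2 - \<delta> * t\<^sup>2) 0"
  by (simp add: elt_power_q elt_mult power2_eq_square algebra_simps)

lemma coords_elt [simp]: "coords emb eps (elt s t) = (s, t)"
  unfolding coords_def
proof (rule the_equality)
  show "p = (s, t)" if "elt s t = emb (fst p) + eps * emb (snd p)" for p
    using that by (simp flip: elt_def add: prod_eq_iff)
qed (simp add: elt_def)

lemma coords_emb [simp]: "coords emb eps (emb s) = (s, 0)"
  by (simp add: emb_conv_elt)

lemma coords_0 [simp]: "coords emb eps 0 = (0, 0)"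
  using coords_emb[of 0] by simp

lemma coords_1 [simp]: "coords emb eps 1 = (1, 0)"
  using coords_emb[of 1] by simp

lemma coords_add: "coords emb eps (x + y) = coords emb eps x + coords emb eps y"
  by (cases x rule: elt_cases; cases y rule: elt_cases) (simp add: elt_add)

lemma coords_emb_mult: "coords emb eps (emb c * x) = (c * fst (coords emb eps x), c * snd (coords emb eps x))"
  by (cases x rule: elt_cases) (simp add: emb_conv_elt elt_mult)

lemma coords_inj: "coords emb eps x = coords emb eps y \<longleftrightarrow> x = y"
  by (cases x rule: elt_cases; cases y rule: elt_cases) simp

section \<open>The Barlotti--Cofman map on vectors\<close>

lemma bc_vec_add: "bc_vec emb eps (v + w) = bc_vec emb eps v + bc_vec emb eps w"
  by (simp add: bc_vec_def vec_eq_iff_7 coords_add)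

lemma bc_vec_scale: "bc_vec emb eps (emb c *s v) = c *s bc_vec emb eps v"
  by (simp add: bc_vec_def vec_eq_iff_7 coords_emb_mult)

text \<open>Of entry 0 only the first coordinate is kept by \<open>bc_vec\<close>, so this entry is
  restricted to GF(q).\<close>

lemma bc_vec_inj:
  assumes "v $ 0 \<in> range emb" "w $ 0 \<in> range emb" "bc_vec emb eps v = bc_vec emb eps w"
  shows "v = w"
proof -
  have "v $ i = w $ i" if "i \<in> {0, 1, 2, 3}" for i
    using assms that
    by (auto simp: bc_vec_def vec_eq_iff_7 prod_eq_iff simp flip: coords_inj)
  then show ?thesis by (simp add: vec_eq_iff_4)
qed

lemma bc_vec_0 [simp]: "bc_vec emb eps 0 = 0"
  by (simp add: bc_vec_def vec_eq_iff_7)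

lemma bc_vec_eq_0_iff: "v $ 0 = 0 \<Longrightarrow> bc_vec emb eps v = 0 \<longleftrightarrow> v = 0"
  using bc_vec_inj[of v 0] by (metis bc_vec_0 emb_0 rangeI zero_index)

lemma bc_vec_nth_0: "v $ 0 = emb j \<Longrightarrow> bc_vec emb eps v $ 0 = j"
  by (simp add: bc_vec_def)

lemma bc_vec_surj:
  obtains x y z where "u = bc_vec emb eps (vec4 (emb (u $ 0)) x y z)"
proof
  show "u = bc_vec emb eps (vec4 (emb (u $ 0)) (elt (u $ 1) (u $ 2)) (elt (u $ 3) (u $ 4)) (elt (u $ 5) (u $ 6)))"
    by (simp add: bc_vec_def vec_eq_iff_7)
qed

text \<open>One equivalence serves both parts of the variety: \<open>j = 1\<close> for affine points
  and \<open>j = 0\<close> at infinity. The norms lie in GF(q), so only \<open>b1\<close> survives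
  from \<open>b\<close> in the second coordinate.\<close>

lemma cone_poly_bc_vec:
  assumes "u = bc_vec emb eps (vec4 (emb j) x y z)" "a = elt a0 a1" "b = elt b0 b1"
  shows "cone_poly \<delta> a0 a1 b1 (u $ 0) (u $ 1) (u $ 2) (u $ 3) (u $ 4) (u $ 6) = 0 \<longleftrightarrow>
    emb j * z + a * (x\<^sup>2 + y\<^sup>2) - b * (x ^ (q + 1) + y ^ (q + 1)) \<in> range emb"
proof -
  obtain x1 x2 y1 y2 z1 z2 where xyz: "x = elt x1 x2" "y = elt y1 y2" "z = elt z1 z2"
    by (meson elt_cases)
  have "emb j * z + a * (x\<^sup>2 + y\<^sup>2) - b * (x ^ (q + 1) + y ^ (q + 1)) \<in> range emb \<longleftrightarrow>
      j * z2 + (a0 * (2 * x1 * x2 + 2 * y1 * y2) + a1 * (x1\<^sup>2 + \<delta> * x2\<^sup>2 + (y1\<^sup>2 + \<delta> * y2\<^sup>2)))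
        - b1 * (x1\<^sup>2 - \<delta> * x2\<^sup>2 + (y1\<^sup>2 - \<delta> * y2\<^sup>2)) = 0"
    unfolding xyz assms(2,3) emb_conv_elt elt_square elt_norm elt_mult elt_add elt_diff elt_mem_range_emb
    by simp
  moreover have "cone_poly \<delta> a0 a1 b1 (u $ 0) (u $ 1) (u $ 2) (u $ 3) (u $ 4) (u $ 6) =
      j * z2 + (a0 * (2 * x1 * x2 + 2 * y1 * y2) + a1 * (x1\<^sup>2 + \<delta> * x2\<^sup>2 + (y1\<^sup>2 + \<delta> * y2\<^sup>2)))
        - b1 * (x1\<^sup>2 - \<delta> * x2\<^sup>2 + (y1\<^sup>2 - \<delta> * y2\<^sup>2))"
    by (simp add: assms(1) xyz bc_vec_def cone_poly_def algebra_simps)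
  ultimately show ?thesis by simp
qed

lemma norm_form_bc_vec:
  assumes "u = bc_vec emb eps v"
  shows "(u $ 1)\<^sup>2 - \<delta> * (u $ 2)\<^sup>2 + (u $ 3)\<^sup>2 - \<delta> * (u $ 4)\<^sup>2 = 0 \<longleftrightarrow>
    (v $ 1) ^ (q + 1) + (v $ 2) ^ (q + 1) = 0"
proof -
  obtain x1 x2 y1 y2 where xy: "v $ 1 = elt x1 x2" "v $ 2 = elt y1 y2"
    by (meson elt_cases)
  have "(v $ 1) ^ (q + 1) + (v $ 2) ^ (q + 1) = emb (x1\<^sup>2 - \<delta> * x2\<^sup>2 + (y1\<^sup>2 - \<delta> * y2\<^sup>2))"
    by (simp only: xy elt_norm flip: emb_conv_elt emb_add)
  then show ?thesis by (simp only: emb_eq_0_iff) (simp add: assms xy bc_vec_def algebra_simps)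
qed

lemma card_norm_minus_one: "card {t::'a. t ^ (q + 1) = -1} = q + 1"
proof (rule antisym)
  show "card {t::'a. t ^ (q + 1) = -1} \<le> q + 1" by (rule card_power_roots_le) simp
next
  \<comment> \<open>The \<open>q - 1\<close> fibres of the norm have at most \<open>q + 1\<close> elements each and cover \<open>q^2 - 1\<close> elements,
    so none of them can be smaller.\<close>
  let ?F = "\<lambda>c. {t. t ^ (q + 1) = emb c}"
  have norm: "\<exists>c. t ^ (q + 1) = emb c" for t
    by (cases t rule: elt_cases) (use elt_norm emb_conv_elt in metis)
  have "UNIV - {0} \<subseteq> (\<Union>c\<in>UNIV - {0}. ?F c)"
  proof
    fix t :: 'a assume "t \<in> UNIV - {0}"
    moreover obtain c where c: "t ^ (q + 1) = emb c" using norm by blast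
    ultimately have "c \<noteq> 0" by auto
    then show "t \<in> (\<Union>c\<in>UNIV - {0}. ?F c)" using c by blast
  qed
  then have "card (UNIV - {0::'a}) \<le> card (\<Union>c\<in>UNIV - {0}. ?F c)" by (intro card_mono) auto
  also have "\<dots> \<le> (\<Sum>c\<in>UNIV - {0}. card (?F c))" by (rule card_UN_le) simp
  also have "\<dots> = card (?F (-1)) + (\<Sum>c\<in>UNIV - {0} - {-1}. card (?F c))"
    by (rule sum.remove) auto
  also have "(\<Sum>c\<in>UNIV - {0} - {-1}. card (?F c)) \<le> (\<Sum>c\<in>UNIV - {0::'k} - {-1}. q + 1)"
    by (intro sum_mono card_power_roots_le) simp
  \<comment> \<open>The values 0 and -1 of the norm are left out, so \<open>q - 2\<close> fibres
    remain.\<close>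
  also have "\<dots> = (q - 2) * (q + 1)"
    by (simp add: card_base numeral_2_eq_2)
  finally have "q\<^sup>2 - 1 \<le> card (?F (-1)) + (q - 2) * (q + 1)"
    by (simp add: card_ext)
  moreover have "q \<ge> 2" using card_mono[of UNIV "{0::'k, 1}"] by (simp add: card_base)
  \<comment> \<open>The substitution removes the truncated subtraction \<open>q - 2\<close>.\<close>
  then obtain r where "q = r + 2" by (metis le_add_diff_inverse2)
  ultimately show "q + 1 \<le> card {t::'a. t ^ (q + 1) = -1}"
    by (simp add: power2_eq_square algebra_simps)
qed

section \<open>Images of affine points and the spread lines\<close>

lemma bc_point_affine: "bc_point emb eps (proj_point (vec4 1 x y z)) = proj_point (bc_vec emb eps (vec4 1 x y z))"
proof -
  have "{v \<in> proj_point (vec4 1 x y z). v $ 0 = 1} = {vec4 1 x y z}"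
    by (auto simp: mem_proj_point intro: exI[of _ 1])
  then show ?thesis by (simp add: bc_point_def proj_point_def)
qed

lemma bc_line_proj_point:
  "bc_line emb eps (proj_point v) = (\<lambda>w. proj_point (bc_vec emb eps w)) ` (proj_point v - {0})"
  by (auto simp: bc_line_def)

text \<open>A GF(q)-multiple of an image vector comes from a multiple by some \<open>emb d\<close>,
  which stays in the GF(q^2)-span of \<open>v\<close>. This is what keeps distinct spread lines
  disjoint.\<close>

lemma mem_bc_line_iff:
  assumes "v $ 0 = 0" "w $ 0 = 0" "w \<noteq> 0"
  shows "proj_point (bc_vec emb eps w) \<in> bc_line emb eps (proj_point v) \<longleftrightarrow> w \<in> proj_point v"
proof
  assume "proj_point (bc_vec emb eps w) \<in> bc_line emb eps (proj_point v)"
  then obtain x where "x \<in> proj_point v" and x: "proj_point (bc_vec emb eps w) = proj_point (bc_vec emb eps x)"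
    unfolding bc_line_proj_point by blast
  then obtain c where c: "proj_point (bc_vec emb eps w) = proj_point (bc_vec emb eps (c *s v))"
    unfolding mem_proj_point by blast
  then have "bc_vec emb eps w \<in> proj_point (bc_vec emb eps (c *s v))"
    using proj_point_self by blast
  then obtain d where "bc_vec emb eps w = bc_vec emb eps (emb d *s (c *s v))"
    unfolding mem_proj_point bc_vec_scale by blast
  then have "w = emb d *s (c *s v)"
    by (rule bc_vec_inj[rotated 2]) (use assms in \<open>auto simp: image_iff intro!: exI[of _ 0]\<close>)
  then show "w \<in> proj_point v" by (auto simp: mem_proj_point)
qed (use assms in \<open>auto simp: bc_line_proj_point\<close>)

lemma bc_line_disjoint:
  assumes "v $ 0 = 0" "v' $ 0 = 0"
    and "bc_line emb eps (proj_point v) \<inter> bc_line emb eps (proj_point v') \<noteq> {}"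
  shows "proj_point v = proj_point v'"
proof -
  obtain w where w: "w \<in> proj_point v" "w \<noteq> 0"
    "proj_point (bc_vec emb eps w) \<in> bc_line emb eps (proj_point v')"
    using assms(3) by (auto simp: bc_line_proj_point)
  then have "w $ 0 = 0" using assms(1) by (auto simp: mem_proj_point)
  then have "w \<in> proj_point v'" using w assms(2) mem_bc_line_iff by blast
  then show ?thesis using w proj_point_eqI by metis
qed

text \<open>The GF(q^2)-span of \<open>v\<close> is a GF(q)-space with basis \<open>v\<close>,
  \<open>eps *s v\<close>. On vectors with entry 0 equal to 0 the map \<open>bc_vec\<close> is
  GF(q)-linear and injective, so the image has dimension 2.\<close>

lemma proj_line_bc_line:
  assumes "v $ 0 = 0" "v \<noteq> 0"
  shows "proj_line (bc_line emb eps (proj_point v))"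
proof -
  let ?\<beta> = "bc_vec emb eps"
  define U where "U = vec.span {?\<beta> v, ?\<beta> (eps *s v)}"
  have sub: "vec.subspace U" by (simp add: U_def)
  have image: "?\<beta> (elt s t *s v) = s *s ?\<beta> v + t *s ?\<beta> (eps *s v)" for s t
  proof -
    have "elt s t *s v = emb s *s v + emb t *s (eps *s v)"
      by (simp add: vec_eq_iff elt_def algebra_simps)
    then show ?thesis by (simp only: bc_vec_add bc_vec_scale)
  qed
  have "U = ?\<beta> ` proj_point v"
  proof (intro subset_antisym subsetI)
    fix u assume "u \<in> U"
    then obtain s t where "u = s *s ?\<beta> v + t *s ?\<beta> (eps *s v)"
      by (auto simp: U_def vec.span_insert vec.span_singleton algebra_simps)
    then show "u \<in> ?\<beta> ` proj_point v" by (auto simp: image_iff mem_proj_point simp flip: image)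
  next
    fix u assume "u \<in> ?\<beta> ` proj_point v"
    then obtain c where "u = ?\<beta> (c *s v)" by (auto simp: mem_proj_point)
    then obtain s t where "u = ?\<beta> (elt s t *s v)" by (metis elt_cases)
    then show "u \<in> U" unfolding image U_def
      by (simp add: vec.span_add vec.span_scale vec.span_base)
  qed
  moreover have "?\<beta> w = 0 \<longleftrightarrow> w = 0" if "w \<in> proj_point v" for w
    using that assms by (intro bc_vec_eq_0_iff) (auto simp: mem_proj_point)
  ultimately have "bc_line emb eps (proj_point v) = proj_subspace U"
    unfolding proj_subspace_eq[OF sub] bc_line_proj_point by auto
  moreover have "vec.dim U = 2"
  proof -
    \<comment> \<open>A dependency would give \<open>(1 - eps * emb c) *s v = 0\<close>, although 1
      and \<open>eps\<close> are independent over GF(q).\<close>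
    have ne: "?\<beta> v \<noteq> c *s ?\<beta> (eps *s v)" for c
    proof
      assume *: "?\<beta> v = c *s ?\<beta> (eps *s v)"
      have "?\<beta> (elt 1 (- c) *s v) = 0" unfolding image using * by simp
      then have "elt 1 (- c) *s v = 0" using assms by (subst (asm) bc_vec_eq_0_iff) simp_all
      then have "elt 1 (- c) = 0" using assms(2) by (metis vec.scale_eq_0_iff)
      also have "0 = elt 0 0" by (simp add: elt_def)
      finally show False by simp
    qed
    have "?\<beta> (eps *s v) \<noteq> 0"
    proof -
      have "eps \<noteq> 0" using eps_notin by (metis emb_0 rangeI)
      then show ?thesis using assms by (subst bc_vec_eq_0_iff) simp_all
    qed
    then have "vec.independent {?\<beta> v, ?\<beta> (eps *s v)}"
      using ne by (auto simp: vec.independent_insert vec.span_singleton)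
    moreover have "?\<beta> v \<noteq> ?\<beta> (eps *s v)" using ne[of 1] by simp
    ultimately show ?thesis by (simp add: U_def vec.dim_span vec.dim_eq_card_independent)
  qed
  ultimately show ?thesis unfolding proj_line_def using sub by blast
qed

section \<open>The BM variety\<close>

text \<open>All representatives of the points at infinity of the variety. The set is closed under
  nonzero scalars, so the points of the corresponding spread lines can be read off from it.\<close>

definition inf_vecs :: "('a ^ 4) set" where
  "inf_vecs = {v. v \<noteq> 0 \<and> v $ 0 = 0 \<and> (v $ 1) ^ (q + 1) + (v $ 2) ^ (q + 1) = 0}"

lemma inf_vecs_scale:
  assumes v: "v \<in> inf_vecs" and w: "w \<in> proj_point v" "w \<noteq> 0"
  shows "w \<in> inf_vecs"
proof -
  obtain c where c: "w = c *s v" using w(1) by (auto simp: mem_proj_point)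
  have "(w $ 1) ^ (q + 1) + (w $ 2) ^ (q + 1) = c ^ (q + 1) * ((v $ 1) ^ (q + 1) + (v $ 2) ^ (q + 1))"
    by (simp only: c vector_smult_component power_mult_distrib distrib_left)
  then show ?thesis using v w(2) c by (simp add: inf_vecs_def del: power_Suc)
qed

lemma BM_variety_eq:
  "BM_variety emb q a b = (\<lambda>(x, y, z). proj_point (vec4 1 x y z)) `
       {(x, y, z). z + a * (x\<^sup>2 + y\<^sup>2) - b * (x ^ (q + 1) + y ^ (q + 1)) \<in> range emb}
     \<union> proj_point ` inf_vecs"
proof -
  have "inf_vecs = (\<lambda>(X, Y, Z). vec4 0 X Y Z) ` {(X, Y, Z). (X, Y, Z) \<noteq> (0, 0, 0) \<and> X ^ (q + 1) + Y ^ (q + 1) = 0}"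
    (is "_ = ?f ` ?S")
  proof (intro subset_antisym subsetI)
    fix v assume "v \<in> inf_vecs"
    then have "v = ?f (v $ 1, v $ 2, v $ 3)" "(v $ 1, v $ 2, v $ 3) \<in> ?S"
      by (auto simp: inf_vecs_def vec_eq_iff_4)
    then show "v \<in> ?f ` ?S" by (rule image_eqI)
  qed (auto simp: inf_vecs_def vec_eq_iff_4)
  then have "proj_point ` inf_vecs = (\<lambda>(X, Y, Z). proj_point (vec4 0 X Y Z)) ` ?S"
    by (simp only: image_image case_prod_unfold)
  also have "\<dots> = {proj_point (vec4 0 X Y Z) | X Y Z. (X, Y, Z) \<noteq> (0, 0, 0) \<and> X ^ (q + 1) + Y ^ (q + 1) = 0}"
    by (auto simp: image_iff simp del: power_Suc)
  finally have inf: "proj_point ` inf_vecs = \<dots>" .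
  show ?thesis
    unfolding BM_variety_def inf by (rule arg_cong2[where f = "(\<union>)"]) (auto simp: image_iff simp del: power_Suc)
qed

lemma proj_point_vec4_1_not_at_infinity: "proj_point (vec4 1 x y z :: 'a ^ 4) \<notin> infinity_hyperplane"
  by (subst proj_point_at_infinity_iff) (simp_all add: vec_eq_iff_4)

lemma proj_point_inf_vecs_subset: "proj_point ` inf_vecs \<subseteq> infinity_hyperplane"
  unfolding infinity_hyperplane_eq by (auto simp: inf_vecs_def)

lemma infinite_part_BM_variety: "infinite_part (BM_variety emb q a b) = proj_point ` inf_vecs"
  unfolding infinite_part_def BM_variety_eq
  using proj_point_vec4_1_not_at_infinity proj_point_inf_vecs_subset by auto

lemma affine_part_BM_variety:
  "affine_part (BM_variety emb q a b) = (\<lambda>(x, y, z). proj_point (vec4 1 x y z)) `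
     {(x, y, z). z + a * (x\<^sup>2 + y\<^sup>2) - b * (x ^ (q + 1) + y ^ (q + 1)) \<in> range emb}"
  unfolding affine_part_def BM_variety_eq
  using proj_point_vec4_1_not_at_infinity proj_point_inf_vecs_subset by auto

section \<open>The correspondence of the affine parts\<close>

text \<open>On both sides an affine point has exactly one representative with entry 0 equal to 1,
  and for these \<open>cone_poly_bc_vec\<close> with \<open>j = 1\<close> matches the two
  equations.\<close>

lemma bij_betw_affine_parts:
  assumes a: "a = elt a0 a1" and b: "b = elt b0 b1"
  shows "bij_betw (bc_point emb eps) (affine_part (BM_variety emb q a b))
    (affine_part (BM_cone \<delta> a0 a1 b1))"
proof (rule bij_betw_imageI)
  show "inj_on (bc_point emb eps) (affine_part (BM_variety emb q a b))"
    unfolding affine_part_BM_variety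
  proof (rule inj_onI, clarsimp simp del: power_Suc)
    fix x y z x' y' z' :: 'a
    let ?v = "vec4 1 x y z" and ?w = "vec4 1 x' y' z'"
    assume "bc_point emb eps (proj_point ?v) = bc_point emb eps (proj_point ?w)"
    then have "bc_vec emb eps ?v \<in> proj_point (bc_vec emb eps ?w)"
      using proj_point_self unfolding bc_point_affine by blast
    then obtain c where c: "bc_vec emb eps ?v = c *s bc_vec emb eps ?w"
      by (auto simp: mem_proj_point)
    \<comment> \<open>Both entries 0 are 1, which forces the scalar to be 1.\<close>
    then have "bc_vec emb eps ?v $ 0 = c * bc_vec emb eps ?w $ 0" by simp
    then have "c = 1" by (simp add: bc_vec_def)
    then have "?v = ?w" using c by (intro bc_vec_inj) (auto simp: image_iff intro: exI[of _ 1])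
    then show "proj_point ?v = proj_point ?w" by simp
  qed
next
  let ?f = "\<lambda>u :: 'k ^ 7. cone_poly \<delta> a0 a1 b1 (u $ 0) (u $ 1) (u $ 2) (u $ 3) (u $ 4) (u $ 6)"
  let ?S = "{(x, y, z). z + a * (x\<^sup>2 + y\<^sup>2) - b * (x ^ (q + 1) + y ^ (q + 1)) \<in> range emb}"
  have iff: "?f (bc_vec emb eps (vec4 1 x y z)) = 0 \<longleftrightarrow> (x, y, z) \<in> ?S" for x y z
    using cone_poly_bc_vec[OF _ a b, of _ 1 x y z] by simp
  have nth_0: "bc_vec emb eps (vec4 1 x y z) $ 0 = 1" for x y z by (simp add: bc_vec_def)
  have ne: "bc_vec emb eps (vec4 1 x y z) \<noteq> 0" for x y z
    using nth_0[of x y z] by (metis zero_index zero_neq_one)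
  have "bc_point emb eps ` affine_part (BM_variety emb q a b)
      = (\<lambda>(x, y, z). proj_point (bc_vec emb eps (vec4 1 x y z))) ` ?S"
    unfolding affine_part_BM_variety image_image by (simp add: case_prod_unfold bc_point_affine)
  also have "\<dots> = affine_part (BM_cone \<delta> a0 a1 b1)"
  proof (intro subset_antisym subsetI)
    fix P assume "P \<in> (\<lambda>(x, y, z). proj_point (bc_vec emb eps (vec4 1 x y z))) ` ?S"
    then obtain x y z where P: "P = proj_point (bc_vec emb eps (vec4 1 x y z))" "(x, y, z) \<in> ?S"
      by auto
    have "P \<in> BM_cone \<delta> a0 a1 b1" unfolding BM_cone_eq P(1) using ne iff P(2) by blast
    moreover have "P \<notin> infinity_hyperplane"
      by (simp add: P(1) proj_point_at_infinity_iff ne nth_0)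
    ultimately show "P \<in> affine_part (BM_cone \<delta> a0 a1 b1)" by (simp add: affine_part_def)
  next
    fix P assume "P \<in> affine_part (BM_cone \<delta> a0 a1 b1)"
    then obtain u where u: "P = proj_point u" "u \<noteq> 0" "?f u = 0" "P \<notin> infinity_hyperplane"
      by (auto simp: affine_part_def BM_cone_eq)
    then have u0: "u $ 0 \<noteq> 0" by (simp add: proj_point_at_infinity_iff)
    define u' where "u' = inverse (u $ 0) *s u"
    have "?f u' = (inverse (u $ 0))\<^sup>2 * ?f u"
      by (simp only: u'_def vector_smult_component cone_poly_homogeneous)
    then have u': "P = proj_point u'" "u' $ 0 = 1" "?f u' = 0"
      using u u0 by (simp_all add: u'_def proj_point_scale)
    obtain x y z where xyz: "u' = bc_vec emb eps (vec4 (emb (u' $ 0)) x y z)" by (rule bc_vec_surj)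
    then have xyz: "u' = bc_vec emb eps (vec4 1 x y z)" by (simp only: u'(2) emb_1)
    have "(x, y, z) \<in> ?S" using u'(3) unfolding xyz iff .
    then show "P \<in> (\<lambda>(x, y, z). proj_point (bc_vec emb eps (vec4 1 x y z))) ` ?S"
      using u'(1) xyz by blast
  qed
  finally show "bc_point emb eps ` affine_part (BM_variety emb q a b) = affine_part (BM_cone \<delta> a0 a1 b1)" .
qed

section \<open>The partition at infinity\<close>

lemma inj_on_bc_line: "inj_on (bc_line emb eps) (proj_point ` inf_vecs)"
proof (rule inj_onI)
  fix P Q assume "P \<in> proj_point ` inf_vecs" "Q \<in> proj_point ` inf_vecs"
    and eq: "bc_line emb eps P = bc_line emb eps Q"
  then obtain v w where vw: "P = proj_point v" "Q = proj_point w" "v $ 0 = 0" "w $ 0 = 0" "v \<noteq> 0"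
    by (auto simp: inf_vecs_def)
  have "proj_point (bc_vec emb eps v) \<in> bc_line emb eps P"
    using vw proj_point_self[of v] by (auto simp: bc_line_proj_point)
  then show "P = Q" using vw eq bc_line_disjoint[of v w] by blast
qed

text \<open>The union of the lines is found by translating the norm equation into coordinates with
  \<open>norm_form_bc_vec\<close>; disjointness is inherited from the spread.\<close>

lemma partition_on_bc_lines:
  "partition_on (infinity_hyperplane \<inter>
      proj_zeros (\<lambda>u. (u $ 1)\<^sup>2 - \<delta> * (u $ 2)\<^sup>2 + (u $ 3)\<^sup>2 - \<delta> * (u $ 4)\<^sup>2))
    (bc_line emb eps ` proj_point ` inf_vecs)"
proof (rule partition_onI)
  let ?g = "\<lambda>u :: 'k ^ 7. (u $ 1)\<^sup>2 - \<delta> * (u $ 2)\<^sup>2 + (u $ 3)\<^sup>2 - \<delta> * (u $ 4)\<^sup>2"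
  let ?\<beta> = "bc_vec emb eps"
  have hom: "?g (c *s u) = c ^ 2 * ?g u" for c u
    by (simp add: power2_eq_square algebra_simps)
  have "\<Union> (bc_line emb eps ` proj_point ` inf_vecs) = proj_point ` ?\<beta> ` inf_vecs"
  proof (intro subset_antisym subsetI)
    fix P assume "P \<in> \<Union> (bc_line emb eps ` proj_point ` inf_vecs)"
    then obtain v w where "v \<in> inf_vecs" "w \<in> proj_point v" "w \<noteq> 0" "P = proj_point (?\<beta> w)"
      by (auto simp: bc_line_proj_point)
    then show "P \<in> proj_point ` ?\<beta> ` inf_vecs" using inf_vecs_scale by blast
  next
    fix P assume "P \<in> proj_point ` ?\<beta> ` inf_vecs"
    then obtain v where v: "v \<in> inf_vecs" "P = proj_point (?\<beta> v)" by blast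
    then have "v \<noteq> 0" by (simp add: inf_vecs_def)
    then show "P \<in> \<Union> (bc_line emb eps ` proj_point ` inf_vecs)"
      using v proj_point_self[of v] by (auto simp: bc_line_proj_point)
  qed
  also have "?\<beta> ` inf_vecs = {u. u \<noteq> 0 \<and> u $ 0 = 0 \<and> ?g u = 0}"
  proof (intro subset_antisym subsetI)
    fix u assume "u \<in> ?\<beta> ` inf_vecs"
    then obtain v where u: "u = ?\<beta> v" and v: "v \<noteq> 0" "v $ 0 = 0" "(v $ 1) ^ (q + 1) + (v $ 2) ^ (q + 1) = 0"
      by (auto simp: inf_vecs_def)
    show "u \<in> {u. u \<noteq> 0 \<and> u $ 0 = 0 \<and> ?g u = 0}"
      using v norm_form_bc_vec[OF u] bc_vec_eq_0_iff[OF v(2)] bc_vec_nth_0[of v 0] u by simp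
  next
    fix u assume u: "u \<in> {u. u \<noteq> 0 \<and> u $ 0 = 0 \<and> ?g u = 0}"
    obtain x y z where xyz: "u = ?\<beta> (vec4 (emb (u $ 0)) x y z)" by (rule bc_vec_surj)
    then have xyz: "u = ?\<beta> (vec4 0 x y z)" using u by simp
    have "vec4 0 x y z \<in> inf_vecs"
      unfolding inf_vecs_def using u norm_form_bc_vec[OF xyz] xyz by (auto simp del: power_Suc)
    then show "u \<in> ?\<beta> ` inf_vecs" using xyz by blast
  qed
  also have "proj_point ` {u. u \<noteq> 0 \<and> u $ 0 = 0 \<and> ?g u = 0} = infinity_hyperplane \<inter> proj_zeros ?g"
    unfolding infinity_hyperplane_eq using proj_point_in_proj_zeros_iff[of ?g 2, OF hom] by blast
  finally show "\<Union> (bc_line emb eps ` proj_point ` inf_vecs) = infinity_hyperplane \<inter> proj_zeros ?g" .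
next
  fix l l' assume "l \<in> bc_line emb eps ` proj_point ` inf_vecs" "l' \<in> bc_line emb eps ` proj_point ` inf_vecs"
    and ne: "l \<noteq> l'"
  then obtain v w where "l = bc_line emb eps (proj_point v)" "l' = bc_line emb eps (proj_point w)"
    "v $ 0 = 0" "w $ 0 = 0" by (auto simp: inf_vecs_def)
  then show "disjnt l l'" using ne bc_line_disjoint[of v w] unfolding disjnt_def by metis
next
  show "{} \<notin> bc_line emb eps ` proj_point ` inf_vecs"
  proof
    assume "{} \<in> bc_line emb eps ` proj_point ` inf_vecs"
    then obtain v where "v \<noteq> 0" "bc_line emb eps (proj_point v) = {}" by (auto simp: inf_vecs_def)
    then show False using proj_point_self[of v] by (auto simp: bc_line_proj_point)
  qed
qed

section \<open>Counting the points at infinity\<close>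

text \<open>In the plane at infinity this is the union of the lines \<open>Y = t X\<close>,
  \<open>t \<in> T\<close>, through their common point \<open>(0,0,0,1)\<close>, which belongs to
  the set even for empty \<open>T\<close>. Each line adds \<open>q^2\<close> further points,
  parametrized by \<open>z\<close>.\<close>

definition slope_points :: "'a set \<Rightarrow> ('a ^ 4) set set" where
  "slope_points T = insert (proj_point (vec4 0 0 0 1)) ((\<lambda>(t, z). proj_point (vec4 0 1 t z)) ` (T \<times> UNIV))"

lemma card_slope_points: "card (slope_points T) = card T * q\<^sup>2 + 1"
proof -
  have "inj_on (\<lambda>(t, z). proj_point (vec4 0 1 t z)) (T \<times> (UNIV :: 'a set))"
  proof (rule inj_onI, clarsimp)
    fix t z t' z' :: 'a assume "proj_point (vec4 0 1 t z) = proj_point (vec4 0 1 t' z')"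
    then obtain c where "vec4 0 1 t z = c *s vec4 0 1 t' z'" using proj_point_self mem_proj_point by blast
    then show "t = t' \<and> z = z'" by (auto simp: vec_eq_iff_4)
  qed
  then have "card ((\<lambda>(t, z). proj_point (vec4 0 1 t z)) ` (T \<times> (UNIV :: 'a set))) = card T * q\<^sup>2"
    by (simp add: card_image card_cartesian_product card_ext)
  moreover have "proj_point (vec4 0 0 0 1) \<notin> (\<lambda>(t, z). proj_point (vec4 0 1 t z)) ` (T \<times> (UNIV :: 'a set))"
  proof
    assume "proj_point (vec4 0 0 0 1) \<in> (\<lambda>(t, z). proj_point (vec4 0 1 t z)) ` (T \<times> (UNIV :: 'a set))"
    then obtain t z :: 'a where "proj_point (vec4 0 0 0 1) = proj_point (vec4 0 1 t z)" by auto
    then obtain c where "vec4 0 1 t z = c *s vec4 0 0 0 (1::'a)" using proj_point_self mem_proj_point by blast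
    then show False by (simp add: vec_eq_iff_4)
  qed
  ultimately show ?thesis by (simp add: slope_points_def)
qed

text \<open>Division by \<open>X\<close> normalizes a point, and \<open>X = 0\<close> forces
  \<open>Y = 0\<close>, leaving only \<open>(0,0,0,1)\<close>. The scaling-invariant predicate
  \<open>R\<close> covers two counts: a trivial \<open>R\<close> for all points at infinity, and
  \<open>X^2 + Y^2 = 0\<close> for those whose line lies in the cone.\<close>

lemma proj_point_inf_vecs_eq:
  assumes "\<And>c x y. c \<noteq> 0 \<Longrightarrow> R (c * x) (c * y) \<longleftrightarrow> R x y" "R 0 0"
  shows "proj_point ` {v \<in> inf_vecs. R (v $ 1) (v $ 2)} = slope_points {t. t ^ (q + 1) = -1 \<and> R 1 t}"
    (is "?L = ?S")
proof (intro subset_antisym subsetI)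
  fix P assume "P \<in> ?L"
  then obtain v where v: "P = proj_point v" "v \<noteq> 0" "v $ 0 = 0"
      "(v $ 1) ^ (q + 1) + (v $ 2) ^ (q + 1) = 0" "R (v $ 1) (v $ 2)"
    by (auto simp: inf_vecs_def)
  show "P \<in> ?S"
  proof (cases "v $ 1 = 0")
    case True
    then have "v $ 2 = 0" using v(4) by auto
    then have "v = (v $ 3) *s vec4 0 0 0 1" using True v(3) by (simp add: vec_eq_iff_4)
    then have "P = proj_point (vec4 0 0 0 1)" using v(1,2) by (metis proj_point_eqI mem_proj_point)
    then show ?thesis by (simp add: slope_points_def)
  next
    case False
    let ?t = "v $ 2 / v $ 1"
    have "v = (v $ 1) *s vec4 0 1 ?t (v $ 3 / v $ 1)" using False v(3) by (simp add: vec_eq_iff_4)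
    then have "P = proj_point (vec4 0 1 ?t (v $ 3 / v $ 1))" using v(1,2) by (metis proj_point_eqI mem_proj_point)
    moreover have "?t ^ (q + 1) = -1"
    proof -
      have "(v $ 2) ^ (q + 1) = - ((v $ 1) ^ (q + 1))"
        using v(4) by (simp only: eq_neg_iff_add_eq_0 add.commute)
      then show ?thesis using False by (simp only: power_divide) simp
    qed
    moreover have "R 1 ?t" using v(5) assms(1)[OF False, of 1 ?t] False by simp
    ultimately show ?thesis unfolding slope_points_def by blast
  qed
next
  fix P assume "P \<in> ?S"
  then consider "P = proj_point (vec4 0 0 0 1)"
    | t z where "P = proj_point (vec4 0 1 t z)" "t ^ (q + 1) = -1" "R 1 t"
    by (auto simp: slope_points_def)
  then show "P \<in> ?L"
  proof cases
    case 1
    have "vec4 0 0 0 1 \<in> {v \<in> inf_vecs. R (v $ 1) (v $ 2)}"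
      using assms(2) by (simp add: inf_vecs_def vec_eq_iff_4)
    then show ?thesis using 1 by blast
  next
    case 2
    have "vec4 0 1 t z \<in> {v \<in> inf_vecs. R (v $ 1) (v $ 2)}"
      using 2 by (simp add: inf_vecs_def vec_eq_iff_4 del: power_Suc)
    then show ?thesis using 2 by blast
  qed
qed

text \<open>The \<open>q + 1\<close> slopes of norm -1 give \<open>(q + 1) q^2 + 1\<close>
  points.\<close>

lemma card_inf_points: "card (proj_point ` inf_vecs) = q ^ 3 + q\<^sup>2 + 1"
  using proj_point_inf_vecs_eq[of "\<lambda>_ _. True"] card_norm_minus_one
  by (simp add: card_slope_points power3_eq_cube power2_eq_square algebra_simps del: power_Suc)

section \<open>Spread lines contained in the cone\<close>

text \<open>The scalar \<open>c = 1\<close> places \<open>e\<close> in GF(q). Then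
  \<open>c = 1 + eps\<close>, whose square has second coordinate 2, forces
  \<open>2 e = 0\<close>.\<close>

lemma scaled_squares_in_base_iff:
  assumes "\<And>c. c \<noteq> 0 \<Longrightarrow> c\<^sup>2 * e \<in> range emb"
  shows "e = 0"
proof -
  obtain k where k: "e = emb k" using assms[of 1] by auto
  have "elt 1 1 \<noteq> 0" using elt_eq_iff[of 1 1 0 0] by (simp add: elt_def)
  then have "(elt 1 1)\<^sup>2 * emb k \<in> range emb" using assms k by simp
  then have "2 * k = 0" unfolding elt_square emb_conv_elt elt_mult elt_mem_range_emb by simp
  then show "e = 0" using two_neq_0 k by simp
qed

lemma bc_line_subset_BM_cone_iff:
  assumes a: "a = elt a0 a1" "a \<noteq> 0" and b: "b = elt b0 b1" and v: "v \<in> inf_vecs"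
  shows "bc_line emb eps (proj_point v) \<subseteq> BM_cone \<delta> a0 a1 b1 \<longleftrightarrow> (v $ 1)\<^sup>2 + (v $ 2)\<^sup>2 = 0"
proof -
  let ?f = "\<lambda>u :: 'k ^ 7. cone_poly \<delta> a0 a1 b1 (u $ 0) (u $ 1) (u $ 2) (u $ 3) (u $ 4) (u $ 6)"
  have *: "proj_point (bc_vec emb eps (c *s v)) \<in> BM_cone \<delta> a0 a1 b1 \<longleftrightarrow>
      c\<^sup>2 * (a * ((v $ 1)\<^sup>2 + (v $ 2)\<^sup>2)) \<in> range emb" if "c \<noteq> 0" for c
  proof -
    let ?w = "c *s v" and ?u = "bc_vec emb eps (c *s v)"
    have w: "?w \<in> inf_vecs" using that v by (intro inf_vecs_scale[OF v]) (auto simp: mem_proj_point, simp add: inf_vecs_def)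
    then have w0: "?w $ 0 = 0" "?w \<noteq> 0" and n: "(?w $ 1) ^ (q + 1) + (?w $ 2) ^ (q + 1) = 0"
      unfolding inf_vecs_def by blast+
    then have "?w = vec4 (emb 0) (?w $ 1) (?w $ 2) (?w $ 3)" by (simp add: vec_eq_iff_4)
    then have u: "?u = bc_vec emb eps (vec4 (emb 0) (?w $ 1) (?w $ 2) (?w $ 3))" by simp
    have "?u \<noteq> 0" using w0 by (simp add: bc_vec_eq_0_iff)
    then have "proj_point ?u \<in> BM_cone \<delta> a0 a1 b1 \<longleftrightarrow> ?f ?u = 0"
      unfolding BM_cone_def
      by (intro proj_point_in_proj_zeros_iff[where d = 2]) (simp_all add: cone_poly_homogeneous)
    \<comment> \<open>With \<open>j = 0\<close> the term in \<open>z\<close> disappears, and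
      \<open>n\<close> cancels the term in \<open>b\<close>.\<close>
    also have "\<dots> \<longleftrightarrow> a * ((?w $ 1)\<^sup>2 + (?w $ 2)\<^sup>2) \<in> range emb"
      unfolding cone_poly_bc_vec[OF u a(1) b] n by simp
    also have "a * ((?w $ 1)\<^sup>2 + (?w $ 2)\<^sup>2) = c\<^sup>2 * (a * ((v $ 1)\<^sup>2 + (v $ 2)\<^sup>2))"
      by (simp add: power_mult_distrib algebra_simps)
    finally show ?thesis .
  qed
  have "v \<noteq> 0" using v by (simp add: inf_vecs_def)
  then have "proj_point v - {0} = (\<lambda>c. c *s v) ` (UNIV - {0})"
    by (auto simp: mem_proj_point intro!: imageI)
  then have "bc_line emb eps (proj_point v) = (\<lambda>c. proj_point (bc_vec emb eps (c *s v))) ` (UNIV - {0})"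
    by (simp only: bc_line_proj_point image_image)
  then have "bc_line emb eps (proj_point v) \<subseteq> BM_cone \<delta> a0 a1 b1 \<longleftrightarrow>
      (\<forall>c. c \<noteq> 0 \<longrightarrow> c\<^sup>2 * (a * ((v $ 1)\<^sup>2 + (v $ 2)\<^sup>2)) \<in> range emb)"
    by (simp add: image_subset_iff Ball_def *)
  also have "\<dots> \<longleftrightarrow> a * ((v $ 1)\<^sup>2 + (v $ 2)\<^sup>2) = 0"
  proof
    assume "a * ((v $ 1)\<^sup>2 + (v $ 2)\<^sup>2) = 0"
    then show "\<forall>c. c \<noteq> 0 \<longrightarrow> c\<^sup>2 * (a * ((v $ 1)\<^sup>2 + (v $ 2)\<^sup>2)) \<in> range emb"
      using emb_0 by (metis mult_zero_right rangeI)
  qed (use scaled_squares_in_base_iff in blast)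
  also have "\<dots> \<longleftrightarrow> (v $ 1)\<^sup>2 + (v $ 2)\<^sup>2 = 0" using a(2) by simp
  finally show ?thesis .
qed

text \<open>The summand 1 is the line of \<open>(0,0,0,1)\<close>, where \<open>X = Y = 0\<close>.
  All other lines in the cone come from slopes that are square roots of -1.\<close>

lemma card_lines_in_BM_cone:
  assumes "a = elt a0 a1" "a \<noteq> 0" "b = elt b0 b1"
  shows "card {l \<in> bc_line emb eps ` proj_point ` inf_vecs. l \<subseteq> BM_cone \<delta> a0 a1 b1}
    = card {t::'a. t ^ (q + 1) = -1 \<and> t\<^sup>2 = -1} * q\<^sup>2 + 1"
proof -
  let ?I = "{v \<in> inf_vecs. (v $ 1)\<^sup>2 + (v $ 2)\<^sup>2 = 0}"
  have "{l \<in> bc_line emb eps ` proj_point ` inf_vecs. l \<subseteq> BM_cone \<delta> a0 a1 b1}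
      = bc_line emb eps ` proj_point ` ?I"
    using bc_line_subset_BM_cone_iff[OF assms] by blast
  also have "card \<dots> = card (proj_point ` ?I)"
    by (rule card_image, rule inj_on_subset[OF inj_on_bc_line]) blast
  also have "proj_point ` ?I = slope_points {t. t ^ (q + 1) = -1 \<and> 1\<^sup>2 + t\<^sup>2 = 0}"
    by (rule proj_point_inf_vecs_eq) (auto simp: power_mult_distrib simp flip: distrib_left)
  also have "{t::'a. t ^ (q + 1) = -1 \<and> 1\<^sup>2 + t\<^sup>2 = 0} = {t. t ^ (q + 1) = -1 \<and> t\<^sup>2 = -1}"
    by (simp only: eq_neg_iff_add_eq_0 power_one add.commute)
  finally show ?thesis by (simp only: card_slope_points)
qed

text \<open>Here -1 has its two square roots already in GF(q), where the norm is squaring, so both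
  have norm -1.\<close>

lemma card_norm_square_minus_one_1:
  assumes "q mod 4 = 1"
  shows "card {t::'a. t ^ (q + 1) = -1 \<and> t\<^sup>2 = -1} = 2"
proof -
  obtain i :: 'k where i: "i\<^sup>2 = -1" using minus_one_square assms card_base by metis
  have "t ^ (q + 1) = -1 \<and> t\<^sup>2 = -1 \<longleftrightarrow> t = emb i \<or> t = emb (- i)" for t
  proof -
    have "(emb i)\<^sup>2 = -1" by (simp add: i flip: emb_power)
    then have "t\<^sup>2 = -1 \<longleftrightarrow> t = emb i \<or> t = emb (- i)"
      by (metis emb_minus power2_eq_iff)
    moreover have "emb s ^ (q + 1) = -1" if "s\<^sup>2 = -1" for s
      using elt_norm[of s 0] that
      by (simp del: power_Suc flip: emb_conv_elt)
    ultimately show ?thesis using i by (metis power2_minus)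
  qed
  then have "{t::'a. t ^ (q + 1) = -1 \<and> t\<^sup>2 = -1} = {emb i, emb (- i)}" by blast
  moreover have "emb i \<noteq> emb (- i)"
  proof
    assume "emb i = emb (- i)"
    then have "i = - i" by (simp only: emb_eq_iff)
    then have "2 * i = 0" by (simp only: mult_2 eq_neg_iff_add_eq_0)
    then show False using i two_neq_0 by simp
  qed
  ultimately show ?thesis by (simp only: card_2_iff) blast
qed

text \<open>Now 4 divides \<open>q + 1\<close>, so a square root of -1 has norm 1, which differs
  from -1 in odd characteristic.\<close>

lemma card_norm_square_minus_one_3:
  assumes "q mod 4 = 3"
  shows "card {t::'a. t ^ (q + 1) = -1 \<and> t\<^sup>2 = -1} = 0"
proof -
  have "q + 1 = 2 * (2 * ((q + 1) div 4))" using assms by presburger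
  then have "t ^ (q + 1) = 1" if "t\<^sup>2 = -1" for t :: 'a
    using that by (metis power_mult power2_minus power_one)
  moreover have "(1::'a) \<noteq> -1"
  proof
    assume "(1::'a) = -1"
    then have "emb 1 = emb (-1)" by simp
    then have "(1::'k) = -1" by (simp only: emb_eq_iff)
    then show False using two_neq_0 by (metis add.right_inverse one_add_one)
  qed
  ultimately have "{t::'a. t ^ (q + 1) = -1 \<and> t\<^sup>2 = -1} = {}" by auto
  then show ?thesis by simp
qed

end

theorem theorem5p4:
  fixes emb :: "'k::{field,finite} \<Rightarrow> 'a::{field,finite}"
    and q :: nat
    and eps a b :: 'a
    and \<delta> a0 a1 b0 b1 :: 'k
  assumes "primepow q" and "odd q"
    and "CARD('k) = q" and "CARD('a) = q^2" and "field_embedding emb"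
    and "eps \<notin> range emb" and "eps ^ q = - eps" and "emb \<delta> = eps ^ 2"
    and "a = emb a0 + eps * emb a1" and "a \<noteq> 0"
    and "b = emb b0 + eps * emb b1" and "b \<notin> range emb"
    and "4 * a^(q+1) + (b^q - b)^2 \<noteq> 0"
  shows "let M = BM_variety emb q a b;
        B' = BM_cone \<delta> a0 a1 b1;
        L = bc_line emb eps ` infinite_part M
    in bij_betw (bc_point emb eps) (affine_part M) (affine_part B')
    \<and> B' = proj_cone (proj_point (vec7 0 0 0 0 0 1 0)) (embed_PG5 ` BM_cone_base \<delta> a0 a1 b1)
    \<and> hyperbolic_quadric5 (BM_cone_base \<delta> a0 a1 b1)
    \<and> L \<subseteq> bc_spread emb eps
    \<and> (\<forall>l\<in>L. proj_line l)
    \<and> inj_on (bc_line emb eps) (infinite_part M)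
    \<and> card L = q^3 + q^2 + 1
    \<and> partition_on (infinity_hyperplane \<inter>
          proj_zeros (\<lambda>v. (v $ 1)^2 - \<delta> * (v $ 2)^2 + (v $ 3)^2 - \<delta> * (v $ 4)^2)) L
    \<and> (q mod 4 = 1 \<longrightarrow> card {l \<in> L. l \<subseteq> B'} = 2 * q^2 + 1)
    \<and> (q mod 4 = 3 \<longrightarrow> card {l \<in> L. l \<subseteq> B'} = 1)"
proof -
  interpret quadratic_extension emb q eps \<delta>
    by unfold_locales fact+
  have a: "a = elt a0 a1" and b: "b = elt b0 b1"
    using assms(9,11) by (simp_all only: elt_def)
  \<comment> \<open>As \<open>b^q - b = -2 eps b1\<close>, the hypothesis on \<open>a\<close> and
    \<open>b\<close> becomes four times the quantity whose nonvanishing makes the binary form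
    nondegenerate.\<close>
  have "4 * a ^ (q + 1) + (b ^ q - b)\<^sup>2 = emb (4 * (a0\<^sup>2 - \<delta> * (a1\<^sup>2 - b1\<^sup>2)))"
  proof -
    have four: "(4::'a) = emb 4" using emb_add[of 2 2] emb_add[of 1 1] by simp
    show ?thesis
      unfolding a b elt_norm elt_power_q elt_diff elt_square four emb_conv_elt elt_mult elt_add elt_eq_iff
      by (simp add: power2_eq_square algebra_simps)
  qed
  then have "a0\<^sup>2 - \<delta> * (a1\<^sup>2 - b1\<^sup>2) \<noteq> 0" using assms(13) by (metis emb_0 mult_zero_right)
  then have hyperbolic: "hyperbolic_quadric5 (BM_cone_base \<delta> a0 a1 b1)"
    by (rule hyperbolic_BM_cone_base[OF two_neq_0])
  have spread: "bc_line emb eps ` proj_point ` inf_vecs \<subseteq> bc_spread emb eps"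
    unfolding bc_spread_def infinity_hyperplane_eq by (intro image_mono) (auto simp: inf_vecs_def)
  have lines: "\<forall>l\<in>bc_line emb eps ` proj_point ` inf_vecs. proj_line l"
    using proj_line_bc_line by (auto simp: inf_vecs_def)
  have card: "card (bc_line emb eps ` proj_point ` inf_vecs) = q ^ 3 + q\<^sup>2 + 1"
    by (simp only: card_image[OF inj_on_bc_line] card_inf_points)
  have card1: "q mod 4 = 1 \<longrightarrow> card {l \<in> bc_line emb eps ` proj_point ` inf_vecs.
      l \<subseteq> BM_cone \<delta> a0 a1 b1} = 2 * q\<^sup>2 + 1"
    by (intro impI) (simp only: card_lines_in_BM_cone[OF a assms(10) b] card_norm_square_minus_one_1)
  have card3: "q mod 4 = 3 \<longrightarrow> card {l \<in> bc_line emb eps ` proj_point ` inf_vecs.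
      l \<subseteq> BM_cone \<delta> a0 a1 b1} = 1"
    by (intro impI) (simp only: card_lines_in_BM_cone[OF a assms(10) b] card_norm_square_minus_one_3 mult_0 add_0)
  show ?thesis
    unfolding Let_def infinite_part_BM_variety
    by (intro conjI bij_betw_affine_parts[OF a b] BM_cone_conv_proj_cone hyperbolic spread lines
        inj_on_bc_line card partition_on_bc_lines card1 card3)
qed

end
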